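(* Let $\Omega=[x_0,x_1]\times[y_0,y_1]\times[z_0,z_1]\subset\mathbb{R}^3$, $T>0$, and let $u\in C^{6,6,6,6}_{x,y,z,t}(\Omega\times[0,T])$ be the solution of the acoustic wave problem $$u_{tt}=c(x,y,z)\,(u_{xx}+u_{yy}+u_{zz})+s(x,y,z,t)\ \text{ in }\Omega\times[0,T],$$ $$u(x,y,z,0)=f_1(x,y,z),\quad u_t(x,y,z,0)=f_2(x,y,z)\ \text{ in }\Omega,\qquad u=g\ \text{ on }\partial\Omega\times[0,T],$$ where $c=\nu^2$ and $\nu$ is the wave velocity, and suppose $c\in C^{2,2,2}_{x,y,z}(\Omega)$. Let $\tau,h_x,h_y,h_z$ be the step sizes in $t,x,y,z$ and $\lambda_x=\tau^2/h_x^2$, $\lambda_y=\tau^2/h_y^2$, $\lambda_z=\tau^2/h_z^2$. Then the compact ADI finite difference scheme $$\begin{aligned} &\left[1-\frac{\lambda_xc_{i,j,k}}{12}\frac{\delta_x^2}{1+\frac{\delta_x^2}{12}}\right]\left[1-\frac{\lambda_yc_{i,j,k}}{12}\frac{\delta_y^2}{1+\frac{\delta_y^2}{12}}\right]\left[1-\frac{\lambda_zc_{i,j,k}}{12}\frac{\delta_z^2}{1+\frac{\delta_z^2}{12}}\right]\delta_t^2u^n_{i,j,k}\\ &\qquad=c_{i,j,k}\left[\frac{\lambda_x\delta_x^2}{1+\frac{\delta_x^2}{12}}+\frac{\lambda_y\delta_y^2}{1+\frac{\delta_y^2}{12}}+\frac{\lambda_z\delta_z^2}{1+\frac{\delta_z^2}{12}}\right]u^n_{i,j,k}+\tau^2\left(1+\frac{\delta_t^2}{12}\right)s^n_{i,j,k}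 \end{aligned}$$ is fourth-order accurate in time and space, with truncation error $O(\tau^4+h_x^4+h_y^4+h_z^4)$.
   Context: The box $\Omega$ is discretized by a uniform $N_x\times N_y\times N_z$ grid $(x_i,y_j,z_k)$ with spacings $h_x,h_y,h_z$, and time levels are $t_n=n\tau$; $u^n_{i,j,k}$ is the numerical solution at $(x_i,y_j,z_k,n\tau)$, $c_{i,j,k}=c(x_i,y_j,z_k)$, $s^n_{i,j,k}=s(x_i,y_j,z_k,n\tau)$. For a grid function $v^n_{i,j,k}$ the central difference operators (without division by the step size) are $\delta_t^2v^n_{i,j,k}=v^{n-1}_{i,j,k}-2v^n_{i,j,k}+v^{n+1}_{i,j,k}$, $\delta_x^2v^n_{i,j,k}=v^n_{i-1,j,k}-2v^n_{i,j,k}+v^n_{i+1,j,k}$, and similarly $\delta_y^2$ (index $j$) and $\delta_z^2$ (index $k$). The symbol $\frac{\delta_x^2}{1+\frac{1}{12}\delta_x^2}$ denotes $\left(1+\frac{1}{12}\delta_x^2\right)^{-1}\delta_x^2$, used as the compact fourth-order Padé approximation: for sufficiently smooth $v$ it is understood that $\frac{1}{h_x^2}\frac{\delta_x^2}{1+\frac1{12}\delta_x^2}v=v_{xx}+O(h_x^4)$ and $\frac{\delta_x^2}{1+\frac1{12}\delta_x^2}v=\delta_x^2\left(1-\frac{1}{12}\delta_x^2\right)v+O(h_x^6)$ at grid points; likewise for $y$, $z$, and $\frac{1}{\tau^2}\frac{\delta_t^2}{1+\frac1{12}\delta_t^2}v=v_{tt}+O(\tau^4)$. In a product of operators, $c_{i,j,k}$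 denotes pointwise multiplication by the grid function $c(x_i,y_j,z_k)$, and operators act from right to left (multiplication by $c$ does not commute with the difference operators). $u\in C^{6,6,6,6}_{x,y,z,t}(\Omega\times[0,T])$ means that $u$ has continuous, bounded partial derivatives (including mixed ones) of order up to $6$ in each of the variables $x,y,z,t$; $c\in C^{2,2,2}_{x,y,z}(\Omega)$ means the same with order up to $2$ in each of $x,y,z$. The truncation error is the residual obtained by inserting the exact solution $u(x_i,y_j,z_k,n\tau)$ into the scheme, normalized so that the scheme is an approximation of the differential equation itself (i.e. both sides divided by $\tau^2$). *)

theory Defs
  imports "HOL-Analysis.Analysis" "HOL-Computational_Algebra.Polynomial"
begin

(* Partial derivative of f in direction b relative to S; at boundary points of a closed box
   this is the one-sided derivative. *)
definition partial_deriv ::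
    "'a::euclidean_space set \<Rightarrow> 'a \<Rightarrow> ('a \<Rightarrow> real) \<Rightarrow> 'a \<Rightarrow> real" where
  "partial_deriv S b f p =
     vector_derivative (\<lambda>r. f (p + r *\<^sub>R b)) (at 0 within {r. p + r *\<^sub>R b \<in> S})"

definition partial_derivs ::
    "'a::euclidean_space set \<Rightarrow> 'a list \<Rightarrow> ('a \<Rightarrow> real) \<Rightarrow> 'a \<Rightarrow> real" where
  "partial_derivs S bs f = foldr (partial_deriv S) bs f"

(* C^{m,...,m}(S): all partial derivatives, mixed ones in any order included, that differentiate
   at most m times in each single variable exist, are continuous and bounded on S. *)
definition C_each_variable :: "nat \<Rightarrow> 'a::euclidean_space set \<Rightarrow> ('a \<Rightarrow> real) \<Rightarrow> bool" where
  "C_each_variable m S f \<longleftrightarrow>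
     (\<forall>bs. set bs \<subseteq> Basis \<and> (\<forall>b\<in>Basis. count_list bs b \<le> m) \<longrightarrow>
        continuous_on S (partial_derivs S bs f) \<and>
        bounded (partial_derivs S bs f ` S) \<and>
        (\<forall>b\<in>Basis. count_list bs b < m \<longrightarrow>
           (\<forall>p\<in>S. (\<lambda>r. partial_derivs S bs f (p + r *\<^sub>R b))
                     differentiable (at 0 within {r. p + r *\<^sub>R b \<in> S}))))"

(* Points of space-time are pairs ((x, y, z), t). *)
definition dir_x :: "(real \<times> real \<times> real) \<times> real" where "dir_x = ((1, 0, 0), 0)"
definition dir_y :: "(real \<times> real \<times> real) \<times> real" where "dir_y = ((0, 1, 0), 0)"
definition dir_z :: "(real \<times> real \<times> real) \<times> real" where "dir_z = ((0, 0, 1), 0)"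
definition dir_t :: "(real \<times> real \<times> real) \<times> real" where "dir_t = ((0, 0, 0), 1)"

definition acoustic_solution ::
    "(real \<times> real \<times> real) set \<Rightarrow> real \<Rightarrow> (real \<times> real \<times> real \<Rightarrow> real) \<Rightarrow>
     ((real \<times> real \<times> real) \<times> real \<Rightarrow> real) \<Rightarrow>
     (real \<times> real \<times> real \<Rightarrow> real) \<Rightarrow> (real \<times> real \<times> real \<Rightarrow> real) \<Rightarrow>
     ((real \<times> real \<times> real) \<times> real \<Rightarrow> real) \<Rightarrow> ((real \<times> real \<times> real) \<times> real \<Rightarrow> real) \<Rightarrow> bool"
  where
  "acoustic_solution \<Omega> T c s f1 f2 g u \<longleftrightarrow>
     (\<forall>p\<in>\<Omega>. \<forall>t\<in>{0..T}.
        partial_derivs (\<Omega> \<times> {0..T}) [dir_t, dir_t] u (p, t) =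
          c p * (partial_derivs (\<Omega> \<times> {0..T}) [dir_x, dir_x] u (p, t)
               + partial_derivs (\<Omega> \<times> {0..T}) [dir_y, dir_y] u (p, t)
               + partial_derivs (\<Omega> \<times> {0..T}) [dir_z, dir_z] u (p, t))
          + s (p, t)) \<and>
     (\<forall>p\<in>\<Omega>. u (p, 0) = f1 p) \<and>
     (\<forall>p\<in>\<Omega>. partial_deriv (\<Omega> \<times> {0..T}) dir_t u (p, 0) = f2 p) \<and>
     (\<forall>p\<in>frontier \<Omega>. \<forall>t\<in>{0..T}. u (p, t) = g (p, t))"

(* The truncated subtraction is harmless: only indices i > 0 are ever used. *)
definition central_diff2 :: "(nat \<Rightarrow> real) \<Rightarrow> nat \<Rightarrow> real" where
  "central_diff2 v i = v (i - 1) - 2 * v i + v (i + 1)"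

(* On a grid line with nodes 0, ..., N the equation (1 + delta^2/12) w = delta^2 v makes sense at
   the interior nodes only, so inverting 1 + delta^2/12 needs values of w at the two end nodes.
   They are obtained from v by a one-sided difference formula with coefficients a (mirrored at
   the right end). The convention that the compact operator, divided by h^2, approximates the
   second derivative to fourth order at the grid points requires the same of this end formula,
   that is, exactness for polynomials of degree at most 5. *)
definition end_formula :: "real list \<Rightarrow> bool" where
  "end_formula a \<longleftrightarrow>
     (\<forall>p :: real poly. degree p \<le> 5 \<longrightarrow>
        (\<Sum>j<length a. a ! j * poly p (real j)) = poly (pderiv (pderiv p)) 0)"

definition pade_rel :: "real list \<Rightarrow> nat \<Rightarrow> (nat \<Rightarrow> real) \<Rightarrow> (nat \<Rightarrow> real) \<Rightarrow> bool" where
  "pade_rel a N v w \<longleftrightarrow>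
     (\<forall>i. 0 < i \<and> i < N \<longrightarrow> w i + central_diff2 w i / 12 = central_diff2 v i) \<and>
     w 0 = (\<Sum>j<length a. a ! j * v j) \<and>
     w N = (\<Sum>j<length a. a ! j * v (N - j)) \<and>
     (\<forall>i>N. w i = 0)"

(* The operator delta^2 / (1 + delta^2/12), i.e. (1 + delta^2/12)^(-1) delta^2. *)
definition pade :: "real list \<Rightarrow> nat \<Rightarrow> (nat \<Rightarrow> real) \<Rightarrow> nat \<Rightarrow> real" where
  "pade a N v = (THE w. pade_rel a N v w)"

type_synonym grid_fun = "nat \<Rightarrow> nat \<Rightarrow> nat \<Rightarrow> real"

definition along_x :: "((nat \<Rightarrow> real) \<Rightarrow> nat \<Rightarrow> real) \<Rightarrow> grid_fun \<Rightarrow> grid_fun" where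
  "along_x F v i j k = F (\<lambda>i'. v i' j k) i"

definition along_y :: "((nat \<Rightarrow> real) \<Rightarrow> nat \<Rightarrow> real) \<Rightarrow> grid_fun \<Rightarrow> grid_fun" where
  "along_y F v i j k = F (\<lambda>j'. v i j' k) j"

definition along_z :: "((nat \<Rightarrow> real) \<Rightarrow> nat \<Rightarrow> real) \<Rightarrow> grid_fun \<Rightarrow> grid_fun" where
  "along_z F v i j k = F (\<lambda>k'. v i j k') k"

(* A time-dependent grid function takes the time level as its first argument. *)
definition delta_t2 :: "(nat \<Rightarrow> grid_fun) \<Rightarrow> nat \<Rightarrow> grid_fun" where
  "delta_t2 v n i j k = central_diff2 (\<lambda>m. v m i j k) n"

(* The bracket 1 - (lam c / 12) P. *)
definition adi_factor :: "real \<Rightarrow> grid_fun \<Rightarrow> (grid_fun \<Rightarrow> grid_fun) \<Rightarrow> grid_fun \<Rightarrow> grid_fun" where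
  "adi_factor lam c P v i j k = v i j k - lam * c i j k / 12 * P v i j k"

(* Px, Py, Pz are the compact operators in the three directions. *)
definition adi_lhs ::
    "real \<Rightarrow> real \<Rightarrow> real \<Rightarrow> real \<Rightarrow> (grid_fun \<Rightarrow> grid_fun) \<Rightarrow> (grid_fun \<Rightarrow> grid_fun) \<Rightarrow>
     (grid_fun \<Rightarrow> grid_fun) \<Rightarrow> grid_fun \<Rightarrow> (nat \<Rightarrow> grid_fun) \<Rightarrow> nat \<Rightarrow> grid_fun" where
  "adi_lhs \<tau> hx hy hz Px Py Pz c u n =
     adi_factor (\<tau>\<^sup>2 / hx\<^sup>2) c Px (adi_factor (\<tau>\<^sup>2 / hy\<^sup>2) c Py (adi_factor (\<tau>\<^sup>2 / hz\<^sup>2) c Pz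
       (delta_t2 u n)))"

definition adi_rhs ::
    "real \<Rightarrow> real \<Rightarrow> real \<Rightarrow> real \<Rightarrow> (grid_fun \<Rightarrow> grid_fun) \<Rightarrow> (grid_fun \<Rightarrow> grid_fun) \<Rightarrow>
     (grid_fun \<Rightarrow> grid_fun) \<Rightarrow> grid_fun \<Rightarrow> (nat \<Rightarrow> grid_fun) \<Rightarrow> (nat \<Rightarrow> grid_fun) \<Rightarrow>
     nat \<Rightarrow> grid_fun" where
  "adi_rhs \<tau> hx hy hz Px Py Pz c u s n i j k =
     c i j k * (\<tau>\<^sup>2 / hx\<^sup>2 * Px (u n) i j k + \<tau>\<^sup>2 / hy\<^sup>2 * Py (u n) i j k
              + \<tau>\<^sup>2 / hz\<^sup>2 * Pz (u n) i j k)
     + \<tau>\<^sup>2 * (s n i j k + delta_t2 s n i j k / 12)"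

definition adi_residual ::
    "real \<Rightarrow> real \<Rightarrow> real \<Rightarrow> real \<Rightarrow> (grid_fun \<Rightarrow> grid_fun) \<Rightarrow> (grid_fun \<Rightarrow> grid_fun) \<Rightarrow>
     (grid_fun \<Rightarrow> grid_fun) \<Rightarrow> grid_fun \<Rightarrow> (nat \<Rightarrow> grid_fun) \<Rightarrow> (nat \<Rightarrow> grid_fun) \<Rightarrow>
     nat \<Rightarrow> grid_fun" where
  "adi_residual \<tau> hx hy hz Px Py Pz c u s n i j k =
     (adi_lhs \<tau> hx hy hz Px Py Pz c u n i j k
      - adi_rhs \<tau> hx hy hz Px Py Pz c u s n i j k) / \<tau>\<^sup>2"


(* The definite description in pade is justified: the tridiagonal system has exactly one
   solution. *)

fun hom_seq :: "nat \<Rightarrow> real" where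
  "hom_seq 0 = 0"
| "hom_seq (Suc 0) = 1"
| "hom_seq (Suc (Suc n)) = - 10 * hom_seq (Suc n) - hom_seq n"

fun part_seq :: "(nat \<Rightarrow> real) \<Rightarrow> real \<Rightarrow> nat \<Rightarrow> real" where
  "part_seq v l 0 = l"
| "part_seq v l (Suc 0) = 0"
| "part_seq v l (Suc (Suc n)) =
     12 * central_diff2 v (Suc n) - 10 * part_seq v l (Suc n) - part_seq v l n"

lemma hom_seq_grows: "\<bar>hom_seq n\<bar> + 1 \<le> \<bar>hom_seq (Suc n)\<bar>"
  by (induction n) auto

lemma pade_rel_shape:
  assumes "pade_rel a N v w" and "i \<le> N"
  shows "w i = part_seq v (\<Sum>j<length a. a ! j * v j) i + w 1 * hom_seq i"
  using assms(2)
proof (induction i rule: hom_seq.induct)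
  case 1
  then show ?case using assms(1) by (simp add: pade_rel_def)
next
  case 2
  then show ?case by simp
next
  case (3 n)
  have "w (Suc n) + central_diff2 w (Suc n) / 12 = central_diff2 v (Suc n)"
    using assms(1) 3(3) by (simp add: pade_rel_def)
  moreover have "central_diff2 w (Suc n) = w n - 2 * w (Suc n) + w (Suc (Suc n))"
    by (simp add: central_diff2_def)
  ultimately have "w (Suc (Suc n)) = 12 * central_diff2 v (Suc n) - 10 * w (Suc n) - w n"
    by linarith
  then show ?case using 3 by (simp add: algebra_simps)
qed

lemma pade_rel_ex1:
  assumes "0 < N"
  shows "\<exists>!w. pade_rel a N v w"
proof (rule ex_ex1I)
  have hN: "hom_seq N \<noteq> 0"
    using hom_seq_grows [of "N - 1"] assms by auto
  define l where "l = (\<Sum>j<length a. a ! j * v j)"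
  define r where "r = (\<Sum>j<length a. a ! j * v (N - j))"
  define \<theta> where "\<theta> = (r - part_seq v l N) / hom_seq N"
  define w where "w i = (if i \<le> N then part_seq v l i + \<theta> * hom_seq i else 0)" for i
  have "w i + central_diff2 w i / 12 = central_diff2 v i" if i: "0 < i" "i < N" for i
  proof -
    from i(1) obtain m where m: "i = Suc m" using gr0_implies_Suc by blast
    show ?thesis using i
      unfolding m central_diff2_def [of w] by (simp add: w_def field_simps)
  qed
  moreover have "w 0 = l" by (simp add: w_def)
  moreover have "w N = r" using hN by (simp add: w_def \<theta>_def)
  moreover have "\<forall>i>N. w i = 0" by (simp add: w_def)
  ultimately have "pade_rel a N v w" by (simp add: pade_rel_def l_def r_def)
  then show "\<exists>w. pade_rel a N v w" by blast
  fix w1 w2 assume w1: "pade_rel a N v w1" and w2: "pade_rel a N v w2"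
  have "w1 N = w2 N" using w1 w2 by (simp add: pade_rel_def)
  then have "w1 1 * hom_seq N = w2 1 * hom_seq N"
    using pade_rel_shape [OF w1, of N] pade_rel_shape [OF w2, of N] by simp
  then have eq1: "w1 1 = w2 1" using hN by simp
  show "w1 = w2"
  proof
    fix i
    show "w1 i = w2 i"
    proof (cases "i \<le> N")
      case True
      show ?thesis
        unfolding pade_rel_shape [OF w1 True] pade_rel_shape [OF w2 True] eq1 ..
    next
      case False
      then show ?thesis using w1 w2 by (simp add: pade_rel_def)
    qed
  qed
qed

lemma pade_rel_pade: "0 < N \<Longrightarrow> pade_rel a N v (pade a N v)"
  unfolding pade_def by (rule theI' [OF pade_rel_ex1])

(* End formulas exist: the classical six-point one-sided second difference. *)
lemma end_formula_six_point:
  "end_formula [15 / 4, - 77 / 6, 107 / 6, - 13, 61 / 12, - 5 / 6]"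
proof -
  have "(\<Sum>j<length a. a ! j * poly p (real j)) = poly (pderiv (pderiv p)) 0"
    if a: "a = [15 / 4, - 77 / 6, 107 / 6, - 13, 61 / 12, - 5 / 6]" and p: "degree p \<le> 5"
    for a and p :: "real poly"
  proof -
    have e: "poly p x = (\<Sum>i\<le>5. coeff p i * x ^ i)" for x
      unfolding poly_altdef using p
      by (intro sum.mono_neutral_left) (auto simp: coeff_eq_0)
    have "poly (pderiv (pderiv p)) 0 = 2 * coeff p 2"
      by (simp add: poly_0_coeff_0 coeff_pderiv numeral_2_eq_2)
    then show ?thesis
      unfolding e by (simp add: a eval_nat_numeral field_simps)
  qed
  then show ?thesis by (simp add: end_formula_def)
qed

end

theory Submission
  imports Defs
begin

text \<open>
  Write \<open>P\<^sub>x, P\<^sub>y, P\<^sub>z\<close> for the compact operators divided by the squared step sizes,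
  \<open>A\<^sub>x = \<tau>\<^sup>2/12 c P\<^sub>x\<close> and so on, and \<open>V = \<delta>\<^sub>t\<^sup>2 u\<close>.
  Expanding the product of the three brackets without commuting anything gives
  \<open>V - A\<^sub>x V - A\<^sub>y V - A\<^sub>z V\<close> and a remainder made of products of at least two of the \<open>A\<close>.

  The principal part is cheap because the compact operators act on each time level separately and
  linearly: with \<open>\<epsilon>\<close> the error of \<open>P\<^sub>x + P\<^sub>y + P\<^sub>z\<close> as an approximation of the Laplacian
  of \<open>u\<close> on one time level, and with \<open>s\<close> eliminated by the wave equation,
  the principal part minus the right-hand side is exactly \<open>\<tau>\<^sup>2\<close> times the error of the three-point
  Numerov formula in time minus \<open>\<tau>\<^sup>2 c (1 + \<delta>\<^sub>t\<^sup>2/12) \<epsilon>\<close> (\<open>adi_residual_splitting\<close>).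
  No mixed derivative enters here. The first error is \<open>O(\<tau>\<^sup>4)\<close> by Taylor expansion
  (\<open>three_point_fourth_order\<close>). For the second, the error before division by \<open>h\<^sup>2\<close> satisfies the
  tridiagonal system with an \<open>O(h\<^sup>6)\<close> right-hand side, by the same Taylor expansion, and \<open>O(h\<^sup>6)\<close>
  end values, by exactness of the end formula on quintics; since \<open>1 + \<delta>\<^sup>2/12\<close> is diagonally
  dominant, a discrete maximum principle transports these bounds to every node
  (\<open>pade_fourth_order\<close>).

  The remainder already has a factor \<open>\<tau>\<^sup>4\<close> besides the \<open>\<tau>\<^sup>2\<close> hidden in \<open>V\<close>, so only boundedness of
  expressions such as \<open>P\<^sub>x (c P\<^sub>y V)\<close> is needed, uniformly in the step sizes.
  The factor \<open>P\<^sub>y V\<close> exists on grid points only, so this is done with divided differences in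
  place of derivatives: the maximum principle bounds \<open>P\<^sub>x w\<close> by second divided differences
  of \<open>w\<close> in \<open>x\<close> (\<open>diff_bound_pade\<close>), these commute with \<open>P\<^sub>y\<close> and obey a Leibniz rule
  (\<open>diff_bound_mult\<close>), and for samples of smooth functions they are
  bounded by mixed partial derivatives (\<open>diff_bound_divided_diff\<close>).
  Each \<open>A\<close> thus consumes two differences in its own direction; \<open>adi_cross_terms\<close> does the
  bookkeeping.
\<close>

section \<open>Three-point and one-sided differences of a smooth function of one variable\<close>

text \<open>
  The derivatives are one-sided at the end points of \<open>I\<close>. This matters: grid nodes and time levels
  may lie on the boundary of the domain.
\<close>

definition deriv_tower :: "nat \<Rightarrow> (nat \<Rightarrow> real \<Rightarrow> real) \<Rightarrow> real set \<Rightarrow> real \<Rightarrow> bool" where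
  "deriv_tower m F I M \<longleftrightarrow>
     (\<forall>i<m. \<forall>x\<in>I. (F i has_real_derivative F (Suc i) x) (at x within I)) \<and>
     (\<forall>x\<in>I. \<bar>F m x\<bar> \<le> M)"

lemma deriv_tower_taylor:
  assumes "deriv_tower m F I M" and "convex I" and "i < m" and "w \<in> I" and "z \<in> I"
  shows "\<bar>F i z - (\<Sum>k<m - i. F (i + k) w * (z - w) ^ k / fact k)\<bar>
           \<le> M * \<bar>z - w\<bar> ^ (m - i) / fact (m - i - 1)"
proof -
  have m: "Suc (m - i - 1) = m - i" using assms(3) by simp
  have "norm (F (i + 0) z - (\<Sum>k\<le>m - i - 1. F (i + k) w * (z - w) ^ k / fact k))
          \<le> M * norm (z - w) ^ Suc (m - i - 1) / fact (m - i - 1)"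
    using assms by (intro field_Taylor [where S = I]) (auto simp: deriv_tower_def)
  then show ?thesis
    unfolding lessThan_Suc_atMost [symmetric] m by simp
qed

text \<open>
  The weight \<open>1/12\<close> makes the fourth-derivative terms cancel, and odd terms cancel by symmetry. The
  same identity serves for the time discretization and for the interior rows of the compact operator.
\<close>

lemma three_point_fourth_order:
  assumes F: "deriv_tower 6 F {\<alpha>..\<beta>} M" and "0 < h" and "\<alpha> \<le> y - h" and "y + h \<le> \<beta>"
  shows "\<bar>F 0 (y - h) - 2 * F 0 y + F 0 (y + h)
            - h\<^sup>2 * (F 2 y + (F 2 (y - h) - 2 * F 2 y + F 2 (y + h)) / 12)\<bar> \<le> M * h ^ 6"
proof -
  have mem: "y \<in> {\<alpha>..\<beta>}" "y - h \<in> {\<alpha>..\<beta>}" "y + h \<in> {\<alpha>..\<beta>}" using assms by auto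
  have M: "0 \<le> M" using F mem(1) unfolding deriv_tower_def by (meson abs_ge_zero order_trans)
  note T = deriv_tower_taylor [OF F convex_real_interval(5)]
  define S0 where "S0 r = (\<Sum>k<6. F k y * r ^ k / fact k)" for r
  define S2 where "S2 r = (\<Sum>k<4. F (2 + k) y * r ^ k / fact k)" for r
  have p: "\<bar>F 0 (y - h) - S0 (- h)\<bar> \<le> M * h ^ 6 / 120" "\<bar>F 0 (y + h) - S0 h\<bar> \<le> M * h ^ 6 / 120"
    using T [of 0 y "y - h"] T [of 0 y "y + h"] mem \<open>0 < h\<close> by (simp_all add: S0_def fact_numeral)
  have q: "\<bar>F 2 (y - h) - S2 (- h)\<bar> \<le> M * h ^ 4 / 6" "\<bar>F 2 (y + h) - S2 h\<bar> \<le> M * h ^ 4 / 6"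
    using T [of 2 y "y - h"] T [of 2 y "y + h"] mem \<open>0 < h\<close> by (simp_all add: S2_def fact_numeral)
  \<comment> \<open>The Taylor polynomials satisfy the three-point identity exactly, so only remainders are left.\<close>
  have cancel: "S0 (- h) - 2 * F 0 y + S0 h - h\<^sup>2 * (F 2 y + (S2 (- h) - 2 * F 2 y + S2 h) / 12) = 0"
    by (simp add: S0_def S2_def eval_nat_numeral lessThan_Suc field_simps)
  define A where "A = F 0 (y - h) - S0 (- h)"
  define B where "B = F 0 (y + h) - S0 h"
  define C where "C = F 2 (y - h) - S2 (- h)"
  define D where "D = F 2 (y + h) - S2 h"
  have "F 0 (y - h) - 2 * F 0 y + F 0 (y + h)
            - h\<^sup>2 * (F 2 y + (F 2 (y - h) - 2 * F 2 y + F 2 (y + h)) / 12)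
      = A + B - h\<^sup>2 * (C + D) / 12
        + (S0 (- h) - 2 * F 0 y + S0 h - h\<^sup>2 * (F 2 y + (S2 (- h) - 2 * F 2 y + S2 h) / 12))"
    by (simp add: A_def B_def C_def D_def field_simps)
  also have "\<dots> = A + B - h\<^sup>2 * (C + D) / 12" using cancel by simp
  also have "\<bar>\<dots>\<bar> \<le> \<bar>A\<bar> + \<bar>B\<bar> + h\<^sup>2 * (\<bar>C\<bar> + \<bar>D\<bar>) / 12"
  proof -
    have "\<bar>h\<^sup>2 * (C + D) / 12\<bar> \<le> h\<^sup>2 * (\<bar>C\<bar> + \<bar>D\<bar>) / 12"
      by (simp add: abs_mult mult_left_mono abs_triangle_ineq)
    then show ?thesis by linarith
  qed
  also have "\<dots> \<le> M * h ^ 6 / 120 + M * h ^ 6 / 120 + h\<^sup>2 * (M * h ^ 4 / 6 + M * h ^ 4 / 6) / 12"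
    using p q unfolding A_def B_def C_def D_def
    by (intro add_mono divide_right_mono mult_left_mono) auto
  also have "\<dots> \<le> M * h ^ 6"
  proof -
    have "h\<^sup>2 * (M * h ^ 4 / 6 + M * h ^ 4 / 6) / 12 = M * h ^ 6 / 36"
      by (simp add: field_simps flip: power_add)
    moreover have "0 \<le> M * h ^ 6" using M by simp
    ultimately show ?thesis by linarith
  qed
  finally show ?thesis .
qed

text \<open>
  Exactness on quintics, applied to the Taylor polynomial, leaves only its remainder.
  A negative step \<open>h\<close> covers the mirrored formula at the right end.
\<close>

lemma end_formula_taylor:
  assumes a: "end_formula a" and "0 \<le> M"
    and F: "\<And>j. j < length a \<Longrightarrow>
              \<bar>v j - (\<Sum>k<6. G k * (real j * h) ^ k / fact k)\<bar> \<le> M * \<bar>real j * h\<bar> ^ 6"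
  shows "\<bar>(\<Sum>j<length a. a ! j * v j) - h\<^sup>2 * G 2\<bar>
           \<le> (\<Sum>j<length a. \<bar>a ! j\<bar> * real j ^ 6) * (M * h ^ 6)"
proof -
  define p where "p = (\<Sum>k<6. monom (G k * h ^ k / fact k) k)"
  have poly: "poly p (real j) = (\<Sum>k<6. G k * (real j * h) ^ k / fact k)" for j
    by (simp add: p_def poly_sum poly_monom power_mult_distrib field_simps)
  have "degree p \<le> 5"
    unfolding p_def by (intro degree_sum_le) (auto intro: order_trans [OF degree_monom_le])
  then have "(\<Sum>j<length a. a ! j * poly p (real j)) = poly (pderiv (pderiv p)) 0"
    using a by (simp add: end_formula_def)
  also have "\<dots> = h\<^sup>2 * G 2"
    by (simp add: p_def poly_0_coeff_0 coeff_pderiv coeff_sum numeral_2_eq_2)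
  finally have "(\<Sum>j<length a. a ! j * v j) - h\<^sup>2 * G 2
      = (\<Sum>j<length a. a ! j * (v j - poly p (real j)))"
    by (simp add: right_diff_distrib sum_subtractf)
  also have "\<bar>\<dots>\<bar> \<le> (\<Sum>j<length a. \<bar>a ! j\<bar> * \<bar>v j - poly p (real j)\<bar>)"
    by (rule order_trans [OF sum_abs]) (simp add: abs_mult)
  also have "\<dots> \<le> (\<Sum>j<length a. \<bar>a ! j\<bar> * (M * \<bar>real j * h\<bar> ^ 6))"
    using F by (intro sum_mono mult_left_mono) (auto simp: poly)
  also have "\<dots> = (\<Sum>j<length a. \<bar>a ! j\<bar> * real j ^ 6) * (M * h ^ 6)"
    unfolding sum_distrib_right by (intro sum.cong) (simp_all add: abs_mult power_mult_distrib)
  finally show ?thesis .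
qed

section \<open>Stability and accuracy of the compact operator on a grid line\<close>

lemma pade_eqI: "0 < N \<Longrightarrow> pade_rel a N v w \<Longrightarrow> pade a N v = w"
  using pade_rel_pade pade_rel_ex1 by blast

lemma pade_linear:
  assumes "0 < N"
  shows "pade a N (\<lambda>j. \<alpha> * v j + \<beta> * w j) = (\<lambda>j. \<alpha> * pade a N v j + \<beta> * pade a N w j)"
proof (rule pade_eqI [OF assms])
  note v = pade_rel_pade [OF assms, of a v] and w = pade_rel_pade [OF assms, of a w]
  have comb: "central_diff2 (\<lambda>j. \<alpha> * x j + \<beta> * y j) i
      = \<alpha> * central_diff2 x i + \<beta> * central_diff2 y i" for x y i
    by (simp add: central_diff2_def algebra_simps)
  have interior: "\<alpha> * pade a N v i + \<beta> * pade a N w i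
      + central_diff2 (\<lambda>j. \<alpha> * pade a N v j + \<beta> * pade a N w j) i / 12
      = central_diff2 (\<lambda>j. \<alpha> * v j + \<beta> * w j) i" if "0 < i" "i < N" for i
  proof -
    have "\<alpha> * (pade a N v i + central_diff2 (pade a N v) i / 12)
        + \<beta> * (pade a N w i + central_diff2 (pade a N w) i / 12)
        = \<alpha> * central_diff2 v i + \<beta> * central_diff2 w i"
      using v w that by (simp add: pade_rel_def)
    then show ?thesis unfolding comb by (simp add: field_simps)
  qed
  show "pade_rel a N (\<lambda>j. \<alpha> * v j + \<beta> * w j) (\<lambda>j. \<alpha> * pade a N v j + \<beta> * pade a N w j)"
    unfolding pade_rel_def
  proof (intro conjI allI impI)
    show "\<alpha> * pade a N v i + \<beta> * pade a N w i
      + central_diff2 (\<lambda>j. \<alpha> * pade a N v j + \<beta> * pade a N w j) i / 12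
      = central_diff2 (\<lambda>j. \<alpha> * v j + \<beta> * w j) i" if "0 < i \<and> i < N" for i
      using interior that by blast
  qed (use v w in \<open>simp_all add: pade_rel_def sum_distrib_left algebra_simps sum.distrib\<close>)
qed

text \<open>
  In \<open>1 + \<delta>\<^sup>2/12\<close> the diagonal entry \<open>10/12\<close> exceeds the sum \<open>2/12\<close> of the neighbours by
  \<open>2/3\<close>, so at an interior maximum of \<open>\<bar>e\<bar>\<close> the right-hand side is at least \<open>2/3\<close> of it.
\<close>

lemma discrete_max_principle:
  fixes e :: "nat \<Rightarrow> real"
  assumes int: "\<And>i. 0 < i \<Longrightarrow> i < N \<Longrightarrow> \<bar>e i + central_diff2 e i / 12\<bar> \<le> B"
    and "\<bar>e 0\<bar> \<le> B0" and "\<bar>e N\<bar> \<le> B0" and "i \<le> N"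
  shows "\<bar>e i\<bar> \<le> max (3 / 2 * B) B0"
proof -
  have "finite ((\<lambda>i. \<bar>e i\<bar>) ` {..N})" "(\<lambda>i. \<bar>e i\<bar>) ` {..N} \<noteq> {}" by auto
  from Max_in [OF this] obtain k where k: "k \<le> N" "\<bar>e k\<bar> = Max ((\<lambda>i. \<bar>e i\<bar>) ` {..N})"
    by (metis (no_types, lifting) atMost_iff imageE)
  have le: "\<bar>e j\<bar> \<le> \<bar>e k\<bar>" if "j \<le> N" for j using that by (auto simp: k(2))
  have "\<bar>e k\<bar> \<le> max (3 / 2 * B) B0"
  proof (cases "0 < k \<and> k < N")
    case True
    then have "\<bar>e k + central_diff2 e k / 12\<bar> \<le> B" using int by blast
    moreover have "\<bar>e (k - 1)\<bar> \<le> \<bar>e k\<bar>" "\<bar>e (k + 1)\<bar> \<le> \<bar>e k\<bar>" using le True by auto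
    moreover have "\<bar>x\<bar> \<le> 3 / 2 * B"
      if "\<bar>x + (l - 2 * x + r) / 12\<bar> \<le> B" "\<bar>l\<bar> \<le> \<bar>x\<bar>" "\<bar>r\<bar> \<le> \<bar>x\<bar>" for x l r :: real
      using that by argo
    ultimately have "\<bar>e k\<bar> \<le> 3 / 2 * B" unfolding central_diff2_def by blast
    then show ?thesis by simp
  next
    case False
    then have "k = 0 \<or> k = N" using k(1) by auto
    then show ?thesis using assms(2,3) by auto
  qed
  then show ?thesis using le [OF assms(4)] by linarith
qed

text \<open>
  One constant for both uses of the maximum principle: \<open>3/2\<close> comes from the interior rows and the
  sum from the end formulas, where the sixth powers stem from the Taylor remainder
  at distance \<open>j h\<close> from the end node.
\<close>

definition pade_const :: "real list \<Rightarrow> real" where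
  "pade_const a = 3 / 2 + (\<Sum>j<length a. \<bar>a ! j\<bar> * real j ^ 6)"

lemma pade_const_pos: "0 < pade_const a"
  unfolding pade_const_def by (intro add_pos_nonneg sum_nonneg) auto

lemma pade_const_max:
  assumes "0 \<le> B"
  shows "max (3 / 2 * B) ((\<Sum>j<length a. \<bar>a ! j\<bar> * real j ^ 6) * B) \<le> pade_const a * B"
  using assms by (auto simp: pade_const_def distrib_right intro!: mult_nonneg_nonneg sum_nonneg)

text \<open>
  The end formula annihilates affine sequences. What remains of \<open>v\<close> after subtracting the affine
  sequence through its first two values grows at most like \<open>j\<^sup>2\<close> times the second differences.
\<close>

lemma end_formula_bound:
  assumes a: "end_formula a" and "0 \<le> B"
    and d: "\<And>j. 0 < j \<Longrightarrow> Suc j < length a \<Longrightarrow> \<bar>central_diff2 v j\<bar> \<le> B"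
  shows "\<bar>\<Sum>j<length a. a ! j * v j\<bar> \<le> (\<Sum>j<length a. \<bar>a ! j\<bar> * real j ^ 6) * B"
proof -
  define r where "r j = v j - (v 0 + real j * (v 1 - v 0))" for j
  have step: "\<bar>r (Suc j) - r j\<bar> \<le> real j * B" if "Suc j < length a" for j
    using that
  proof (induction j)
    case 0
    then show ?case by (simp add: r_def)
  next
    case (Suc j)
    have "r (Suc (Suc j)) - r (Suc j) = (r (Suc j) - r j) + central_diff2 v (Suc j)"
      by (simp add: r_def central_diff2_def algebra_simps)
    moreover have "\<bar>r (Suc j) - r j\<bar> \<le> real j * B" using Suc by simp
    moreover have "\<bar>central_diff2 v (Suc j)\<bar> \<le> B" using d [of "Suc j"] Suc.prems by simp
    ultimately show ?case by (simp add: distrib_right)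
  qed
  have sq: "\<bar>r j\<bar> \<le> real j ^ 2 * B" if "j < length a" for j
    using that
  proof (induction j)
    case 0
    then show ?case by (simp add: r_def)
  next
    case (Suc j)
    then have "\<bar>r (Suc j)\<bar> \<le> real j ^ 2 * B + real j * B" using step [of j] by simp
    also have "\<dots> \<le> real (Suc j) ^ 2 * B"
      using \<open>0 \<le> B\<close> by (simp add: power2_eq_square algebra_simps)
    finally show ?case .
  qed
  have "(\<Sum>j<length a. a ! j * poly [:v 0, v 1 - v 0:] (real j)) = 0"
    using a [unfolded end_formula_def, rule_format, of "[:v 0, v 1 - v 0:]"]
    by (simp add: pderiv_pCons)
  then have "(\<Sum>j<length a. a ! j * v j) = (\<Sum>j<length a. a ! j * r j)"
    by (simp add: r_def right_diff_distrib sum_subtractf)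
  also have "\<bar>\<dots>\<bar> \<le> (\<Sum>j<length a. \<bar>a ! j\<bar> * \<bar>r j\<bar>)"
    by (rule order_trans [OF sum_abs]) (simp add: abs_mult)
  also have "\<dots> \<le> (\<Sum>j<length a. \<bar>a ! j\<bar> * (real j ^ 6 * B))"
  proof (intro sum_mono mult_left_mono)
    fix j assume "j \<in> {..<length a}"
    then have "\<bar>r j\<bar> \<le> real j ^ 2 * B" using sq by simp
    also have "\<dots> \<le> real j ^ 6 * B"
      using \<open>0 \<le> B\<close> by (cases "j = 0") (auto intro!: mult_right_mono power_increasing)
    finally show "\<bar>r j\<bar> \<le> real j ^ 6 * B" .
  qed simp
  also have "\<dots> = (\<Sum>j<length a. \<bar>a ! j\<bar> * real j ^ 6) * B"
    by (simp add: sum_distrib_right mult.assoc)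
  finally show ?thesis .
qed

text \<open>
  Stability in the form needed for iterated operators: second differences bound the output, so that
  dividing by \<open>h\<^sup>2\<close> gives a bound that does not depend on the mesh.
\<close>

lemma pade_stable:
  assumes a: "end_formula a" and "length a \<le> N + 1" and "0 < N" and "0 \<le> B" and "i \<le> N"
    and d: "\<And>i. 0 < i \<Longrightarrow> i < N \<Longrightarrow> \<bar>central_diff2 v i\<bar> \<le> B"
  shows "\<bar>pade a N v i\<bar> \<le> pade_const a * B"
proof -
  note w = pade_rel_pade [OF \<open>0 < N\<close>, of a v, unfolded pade_rel_def]
  let ?E = "(\<Sum>j<length a. \<bar>a ! j\<bar> * real j ^ 6) * B"
  have left: "\<bar>pade a N v 0\<bar> \<le> ?E"
    using w end_formula_bound [OF a \<open>0 \<le> B\<close>, of v] d assms(2) by simp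
  \<comment> \<open>The right end formula is the left one for the reversed sequence.\<close>
  have "\<bar>central_diff2 (\<lambda>j. v (N - j)) j\<bar> \<le> B" if "0 < j" "Suc j < length a" for j
  proof -
    have "N - (j - 1) = N - j + 1" "N - (j + 1) = N - j - 1" using that assms(2) by auto
    then have "central_diff2 (\<lambda>j. v (N - j)) j = central_diff2 v (N - j)"
      by (simp add: central_diff2_def)
    then show ?thesis using d [of "N - j"] that assms(2) by simp
  qed
  then have right: "\<bar>pade a N v N\<bar> \<le> ?E"
    using w end_formula_bound [OF a \<open>0 \<le> B\<close>, of "\<lambda>j. v (N - j)"] by simp
  have "\<bar>pade a N v i\<bar> \<le> max (3 / 2 * B) ?E"
    using w d left right \<open>i \<le> N\<close> by (intro discrete_max_principle [where N = N]) auto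
  then show ?thesis using pade_const_max [OF \<open>0 \<le> B\<close>] by (rule order_trans)
qed

text \<open>
  Since \<open>\<delta>\<^sup>2 v\<close> and \<open>(1 + \<delta>\<^sup>2/12) (h\<^sup>2 v'')\<close> agree up to \<open>O(h\<^sup>6)\<close>, the
  difference \<open>e\<close> of the compact operator and \<open>h\<^sup>2 v''\<close> solves the tridiagonal system with
  \<open>O(h\<^sup>6)\<close> data everywhere.
\<close>

lemma pade_fourth_order:
  assumes a: "end_formula a" and len: "length a \<le> N + 1" and "0 < N" and "i \<le> N" and "0 < h"
    and F: "deriv_tower 6 F {\<alpha>..\<alpha> + real N * h} M"
  shows "\<bar>pade a N (\<lambda>j. F 0 (\<alpha> + real j * h)) i - h\<^sup>2 * F 2 (\<alpha> + real i * h)\<bar>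
           \<le> pade_const a * (M * h ^ 6)"
proof -
  define x where "x j = \<alpha> + real j * h" for j
  define v where "v j = F 0 (x j)" for j
  define e where "e j = pade a N v j - h\<^sup>2 * F 2 (x j)" for j
  let ?I = "{\<alpha>..\<alpha> + real N * h}"
  have mem: "x j \<in> ?I" if "j \<le> N" for j using that \<open>0 < h\<close> by (simp add: x_def mult_right_mono)
  have M: "0 \<le> M"
    using F mem [of 0] unfolding deriv_tower_def by (meson abs_ge_zero le0 order_trans)
  have B: "0 \<le> M * h ^ 6" using M by simp
  note w = pade_rel_pade [OF \<open>0 < N\<close>, of a v, unfolded pade_rel_def]
  let ?E = "(\<Sum>j<length a. \<bar>a ! j\<bar> * real j ^ 6) * (M * h ^ 6)"
  have taylor: "\<bar>F 0 z - (\<Sum>k<6. F k y * (z - y) ^ k / fact k)\<bar> \<le> M * \<bar>z - y\<bar> ^ 6"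
    if "y \<in> ?I" "z \<in> ?I" for y z
  proof -
    have "M * \<bar>z - y\<bar> ^ 6 / 120 \<le> M * \<bar>z - y\<bar> ^ 6" using M by simp
    then show ?thesis
      using deriv_tower_taylor [OF F convex_real_interval(5), of 0 y z] that by (simp add: fact_numeral)
  qed
  have int: "\<bar>e j + central_diff2 e j / 12\<bar> \<le> M * h ^ 6" if j: "0 < j" "j < N" for j
  proof -
    have "x (j - 1) = x j - h" "x (j + 1) = x j + h"
      using j by (auto simp: x_def of_nat_diff algebra_simps)
    moreover have "\<alpha> \<le> x j - h" "x j + h \<le> \<alpha> + real N * h"
      using calculation mem [of "j - 1"] mem [of "j + 1"] j by auto
    moreover have "e j + central_diff2 e j / 12 = central_diff2 v j
        - h\<^sup>2 * (F 2 (x j) + (F 2 (x (j - 1)) - 2 * F 2 (x j) + F 2 (x (j + 1))) / 12)"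
    proof -
      have "pade a N v j + central_diff2 (pade a N v) j / 12 = central_diff2 v j" using w j by blast
      then show ?thesis by (simp add: e_def central_diff2_def field_simps)
    qed
    ultimately show ?thesis
      using three_point_fourth_order [OF F \<open>0 < h\<close>, of "x j"]
      by (simp add: v_def central_diff2_def)
  qed
  have left: "\<bar>e 0\<bar> \<le> ?E"
  proof -
    have "\<bar>v j - (\<Sum>k<6. F k (x 0) * (real j * h) ^ k / fact k)\<bar> \<le> M * \<bar>real j * h\<bar> ^ 6"
      if "j < length a" for j
      using taylor [of "x 0" "x j"] mem [of 0] mem [of j] that len by (simp add: v_def x_def)
    from end_formula_taylor [OF a M this] show ?thesis using w by (simp add: e_def)
  qed
  have right: "\<bar>e N\<bar> \<le> ?E"
  proof -
    have "\<bar>v (N - j) - (\<Sum>k<6. F k (x N) * (real j * - h) ^ k / fact k)\<bar>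
        \<le> M * \<bar>real j * - h\<bar> ^ 6"
      if "j < length a" for j
    proof -
      have "x (N - j) - x N = real j * - h" using that len by (simp add: x_def of_nat_diff algebra_simps)
      then show ?thesis using taylor [of "x N" "x (N - j)"] mem by (simp add: v_def)
    qed
    from end_formula_taylor [OF a M this] show ?thesis using w by (simp add: e_def)
  qed
  have "\<bar>e i\<bar> \<le> max (3 / 2 * (M * h ^ 6)) ?E"
    using int left right \<open>i \<le> N\<close> by (rule discrete_max_principle)
  then have "\<bar>e i\<bar> \<le> pade_const a * (M * h ^ 6)" using pade_const_max [OF B] by (rule order_trans)
  then show ?thesis unfolding e_def v_def x_def .
qed

section \<open>Divided differences of functions of several variables\<close>

text \<open>
  The lists of directions admitted by \<^const>\<open>C_each_variable\<close>.
\<close>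

definition multi_order :: "nat \<Rightarrow> 'a::euclidean_space list \<Rightarrow> bool" where
  "multi_order m bs \<longleftrightarrow> set bs \<subseteq> Basis \<and> (\<forall>b\<in>Basis. count_list bs b \<le> m)"

lemma multi_order_Nil [simp]: "multi_order m []"
  by (simp add: multi_order_def)

lemma multi_order_appendD: "multi_order m (bs @ cs) \<Longrightarrow> multi_order m cs"
  by (fastforce simp: multi_order_def dest: add_leD2)

lemma multi_order_ConsD: "multi_order m (b # cs) \<Longrightarrow> multi_order m cs"
  using multi_order_appendD [of m "[b]" cs] by simp

lemma C_each_variableD:
  assumes "C_each_variable m S f" and "multi_order m bs"
  shows "bounded (partial_derivs S bs f ` S)"
    and "b \<in> Basis \<Longrightarrow> count_list bs b < m \<Longrightarrow> p \<in> S \<Longrightarrow>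
           (\<lambda>r. partial_derivs S bs f (p + r *\<^sub>R b))
             differentiable (at 0 within {r. p + r *\<^sub>R b \<in> S})"
proof -
  note all = mp [OF spec [OF assms(1) [unfolded C_each_variable_def]] assms(2) [unfolded multi_order_def]]
  show "bounded (partial_derivs S bs f ` S)"
    by (rule conjunct1 [OF conjunct2 [OF all]])
  show "(\<lambda>r. partial_derivs S bs f (p + r *\<^sub>R b))
      differentiable (at 0 within {r. p + r *\<^sub>R b \<in> S})"
    if "b \<in> Basis" "count_list bs b < m" "p \<in> S"
    by (rule bspec [OF mp [OF bspec [OF conjunct2 [OF conjunct2 [OF all]] that(1)] that(2)] that(3)])
qed

text \<open>
  There are only finitely many admissible lists of directions, so a single constant bounds all
  the derivatives at once.
\<close>

lemma C_each_variable_bound: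
  fixes f :: "'a::euclidean_space \<Rightarrow> real"
  assumes "C_each_variable m S f"
  obtains M where "0 \<le> M"
    and "\<And>bs p. multi_order m bs \<Longrightarrow> p \<in> S \<Longrightarrow> \<bar>partial_derivs S bs f p\<bar> \<le> M"
proof -
  have "length bs \<le> m * DIM('a)" if "multi_order m bs" for bs :: "'a list"
  proof -
    have "length bs = (\<Sum>b\<in>Basis. count_list bs b)"
      using that by (simp add: sum_count_set multi_order_def)
    also have "\<dots> \<le> (\<Sum>b\<in>(Basis :: 'a set). m)"
      using that by (intro sum_mono) (simp add: multi_order_def)
    finally show ?thesis by (simp add: mult.commute)
  qed
  then have "{bs :: 'a list. multi_order m bs}
      \<subseteq> {bs. set bs \<subseteq> Basis \<and> length bs \<le> m * DIM('a)}"
    by (auto simp: multi_order_def)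
  then have fin: "finite {bs :: 'a list. multi_order m bs}"
    using finite_lists_length_le [OF finite_Basis] by (rule finite_subset)
  have "bounded (\<Union>bs\<in>{bs. multi_order m bs}. partial_derivs S bs f ` S)"
    by (intro bounded_UN [OF fin] ballI C_each_variableD(1) [OF assms]) simp
  then obtain M where M: "\<And>x. x \<in> (\<Union>bs\<in>{bs. multi_order m bs}. partial_derivs S bs f ` S) \<Longrightarrow> \<bar>x\<bar> \<le> M"
    unfolding bounded_real by blast
  show thesis
  proof (rule that [of "max M 0"])
    fix bs :: "'a list" and p assume "multi_order m bs" "p \<in> S"
    then have "\<bar>partial_derivs S bs f p\<bar> \<le> M" by (intro M) blast
    then show "\<bar>partial_derivs S bs f p\<bar> \<le> max M 0" by simp
  qed simp
qed

lemma partial_derivs_along: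
  assumes f: "C_each_variable m S f" and ord: "multi_order m (b # cs)"
    and I: "\<And>r. r \<in> I \<Longrightarrow> p + r *\<^sub>R b \<in> S" and r: "r \<in> I"
  shows "((\<lambda>r. partial_derivs S cs f (p + r *\<^sub>R b))
            has_real_derivative partial_derivs S (b # cs) f (p + r *\<^sub>R b)) (at r within I)"
proof -
  define q where "q = p + r *\<^sub>R b"
  define g where "g = partial_derivs S cs f"
  have b: "b \<in> Basis" using ord by (simp add: multi_order_def)
  have q: "q \<in> S" using I r by (simp add: q_def)
  have "count_list cs b < m" using ord b by (auto simp: multi_order_def)
  then have "(\<lambda>t. g (q + t *\<^sub>R b)) differentiable (at 0 within {t. q + t *\<^sub>R b \<in> S})"
    using C_each_variableD(2) [OF f multi_order_ConsD [OF ord] b _ q] by (simp add: g_def)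
  then have D: "((\<lambda>t. g (q + t *\<^sub>R b)) has_real_derivative partial_derivs S (b # cs) f q)
      (at 0 within {t. q + t *\<^sub>R b \<in> S})"
    unfolding vector_derivative_works has_real_derivative_iff_has_vector_derivative
    by (simp add: partial_derivs_def partial_deriv_def g_def)
  have shifted: "q + (s - r) *\<^sub>R b = p + s *\<^sub>R b" for s
    by (simp add: q_def scaleR_diff_left)
  have "(\<lambda>s. s - r) ` I \<subseteq> {t. q + t *\<^sub>R b \<in> S}"
    using I by (auto simp: shifted)
  then have "((\<lambda>t. g (q + t *\<^sub>R b)) has_real_derivative partial_derivs S (b # cs) f q)
      (at (r - r) within (\<lambda>s. s - r) ` I)"
    using DERIV_subset [OF D] by simp
  moreover have "((\<lambda>s. s - r) has_real_derivative 1) (at r within I)"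
    by (rule derivative_eq_intros refl | simp)+
  ultimately have "((\<lambda>t. g (q + t *\<^sub>R b)) \<circ> (\<lambda>s. s - r) has_real_derivative
      partial_derivs S (b # cs) f q * 1) (at r within I)"
    by (rule DERIV_image_chain)
  then show ?thesis by (simp add: o_def shifted g_def) (simp add: q_def)
qed

text \<open>
  Iterated forward difference quotients; an entry \<open>(r, b)\<close> stands for the step \<open>r\<close> in
  direction \<open>b\<close>. For positive steps in coordinate directions all sample points lie in the box between \<open>p\<close> and
  \<open>p + displacement L\<close>.
\<close>

fun divided_diff :: "(real \<times> 'a::real_vector) list \<Rightarrow> ('a \<Rightarrow> real) \<Rightarrow> 'a \<Rightarrow> real" where
  "divided_diff [] f p = f p"
| "divided_diff ((r, b) # L) f p = (divided_diff L f (p + r *\<^sub>R b) - divided_diff L f p) / r"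

definition displacement :: "(real \<times> 'a::real_vector) list \<Rightarrow> 'a" where
  "displacement L = (\<Sum>(r, b)\<leftarrow>L. r *\<^sub>R b)"

lemma displacement_simps [simp]:
  "displacement [] = 0" "displacement ((r, b) # L) = r *\<^sub>R b + displacement L"
  by (simp_all add: displacement_def)

definition forward_steps :: "(real \<times> 'a::euclidean_space) list \<Rightarrow> bool" where
  "forward_steps L \<longleftrightarrow> (\<forall>(r, b)\<in>set L. 0 < r \<and> b \<in> Basis)"

lemma forward_steps_simps [simp]:
  "forward_steps []" "forward_steps ((r, b) # L) \<longleftrightarrow> 0 < r \<and> b \<in> Basis \<and> forward_steps L"
  by (auto simp: forward_steps_def)

lemma inner_Basis_nonneg: "b \<in> Basis \<Longrightarrow> c \<in> Basis \<Longrightarrow> 0 \<le> b \<bullet> c"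
  by (simp add: inner_Basis)

lemma displacement_nonneg: "forward_steps L \<Longrightarrow> c \<in> Basis \<Longrightarrow> 0 \<le> displacement L \<bullet> c"
  by (induction L) (auto simp: inner_add_left inner_Basis_nonneg)

lemma cbox_between:
  assumes "x \<in> cbox l u" and "x + v + w \<in> cbox l u"
    and "\<And>c. c \<in> Basis \<Longrightarrow> 0 \<le> v \<bullet> c" and "\<And>c. c \<in> Basis \<Longrightarrow> 0 \<le> w \<bullet> c"
  shows "x + v \<in> cbox l u"
  unfolding mem_box
proof (intro ballI)
  fix c :: 'a assume c: "c \<in> Basis"
  have "l \<bullet> c \<le> x \<bullet> c" "x \<bullet> c + v \<bullet> c + w \<bullet> c \<le> u \<bullet> c"
    using assms(1,2) c by (auto simp: mem_box inner_add_left)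
  then show "l \<bullet> c \<le> (x + v) \<bullet> c \<and> (x + v) \<bullet> c \<le> u \<bullet> c"
    using assms(3,4) [OF c] by (simp add: inner_add_left)
qed

lemma divided_diff_along:
  assumes f: "C_each_variable m (cbox l u) f" and ord: "multi_order m (b # cs)"
    and "forward_steps L" and r: "r \<in> I"
    and "\<And>r. r \<in> I \<Longrightarrow> p + r *\<^sub>R b \<in> cbox l u"
    and "\<And>r. r \<in> I \<Longrightarrow> p + r *\<^sub>R b + displacement L \<in> cbox l u"
  shows "((\<lambda>r. divided_diff L (partial_derivs (cbox l u) cs f) (p + r *\<^sub>R b))
            has_real_derivative
          divided_diff L (partial_derivs (cbox l u) (b # cs) f) (p + r *\<^sub>R b)) (at r within I)"
  using assms(3,5,6)
proof (induction L arbitrary: p)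
  case Nil
  then show ?case using partial_derivs_along [OF f ord _ r, of p] by simp
next
  case (Cons a L)
  obtain h d where a: "a = (h, d)" by fastforce
  have hd: "0 < h" "d \<in> Basis" "forward_steps L" using Cons.prems(1) by (auto simp: a)
  have mid: "p + r *\<^sub>R b + h *\<^sub>R d \<in> cbox l u" "p + r *\<^sub>R b + displacement L \<in> cbox l u"
    if "r \<in> I" for r
  proof -
    note dnn = displacement_nonneg [OF hd(3)]
    have end_in: "p + r *\<^sub>R b + h *\<^sub>R d + displacement L \<in> cbox l u"
      using Cons.prems(3) [OF that] by (simp add: a algebra_simps)
    show "p + r *\<^sub>R b + h *\<^sub>R d \<in> cbox l u"
      using cbox_between [OF Cons.prems(2) [OF that] end_in] hd dnn
      by (simp add: inner_Basis_nonneg)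
    show "p + r *\<^sub>R b + displacement L \<in> cbox l u"
      using cbox_between [OF Cons.prems(2) [OF that], of "displacement L" "h *\<^sub>R d"] end_in hd dnn
      by (simp add: inner_Basis_nonneg add_ac)
  qed
  have "((\<lambda>r. divided_diff L (partial_derivs (cbox l u) cs f) (p + h *\<^sub>R d + r *\<^sub>R b))
            has_real_derivative
          divided_diff L (partial_derivs (cbox l u) (b # cs) f) (p + h *\<^sub>R d + r *\<^sub>R b)) (at r within I)"
    using mid(1) Cons.prems(3) hd by (intro Cons.IH) (simp_all add: a add_ac)
  moreover have "((\<lambda>r. divided_diff L (partial_derivs (cbox l u) cs f) (p + r *\<^sub>R b))
            has_real_derivative
          divided_diff L (partial_derivs (cbox l u) (b # cs) f) (p + r *\<^sub>R b)) (at r within I)"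
    using mid(2) Cons.prems(2) hd by (intro Cons.IH) auto
  ultimately have "((\<lambda>r. (divided_diff L (partial_derivs (cbox l u) cs f) (p + h *\<^sub>R d + r *\<^sub>R b)
              - divided_diff L (partial_derivs (cbox l u) cs f) (p + r *\<^sub>R b)) / h)
            has_real_derivative
          (divided_diff L (partial_derivs (cbox l u) (b # cs) f) (p + h *\<^sub>R d + r *\<^sub>R b)
              - divided_diff L (partial_derivs (cbox l u) (b # cs) f) (p + r *\<^sub>R b)) / h)
      (at r within I)"
    by (intro DERIV_cdivide DERIV_diff)
  then show ?case by (simp add: a add_ac)
qed

text \<open>
  The mean value theorem, applied to one step at a time, trades each difference quotient for a
  partial derivative. The outermost quotient is treated first, and its derivative ends up
  innermost; hence the reversal of the list.
\<close>

lemma divided_diff_mean_value: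
  assumes f: "C_each_variable m (cbox l u) f"
    and "forward_steps L" and "multi_order m (map snd L @ cs)"
    and "p \<in> cbox l u" and "p + displacement L \<in> cbox l u"
  shows "\<exists>q\<in>cbox l u. divided_diff L (partial_derivs (cbox l u) cs f) p
                       = partial_derivs (cbox l u) (rev (map snd L) @ cs) f q"
  using assms(2-)
proof (induction L arbitrary: cs p)
  case Nil
  then show ?case by (intro bexI [of _ p]) simp_all
next
  case (Cons a L)
  obtain h d where a: "a = (h, d)" by fastforce
  have hd: "0 < h" "d \<in> Basis" "forward_steps L" using Cons.prems(1) by (auto simp: a)
  note dnn = displacement_nonneg [OF hd(3)]
  have ord: "multi_order m (map snd L @ (d # cs))"
    using Cons.prems(2) by (auto simp: a multi_order_def split: if_splits)
  have mid: "p + r *\<^sub>R d \<in> cbox l u" "p + r *\<^sub>R d + displacement L \<in> cbox l u" if "r \<in> {0..h}" for r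
  proof -
    have far: "p + r *\<^sub>R d + ((h - r) *\<^sub>R d + displacement L) \<in> cbox l u"
      using Cons.prems(4) by (simp add: a algebra_simps)
    show "p + r *\<^sub>R d \<in> cbox l u"
      using that hd dnn
      by (intro cbox_between [OF Cons.prems(3) far]) (simp_all add: inner_add_left inner_Basis_nonneg)
    have far: "p + (r *\<^sub>R d + displacement L) + (h - r) *\<^sub>R d \<in> cbox l u"
      using Cons.prems(4) by (simp add: a algebra_simps)
    have "p + (r *\<^sub>R d + displacement L) \<in> cbox l u"
      using that hd dnn
      by (intro cbox_between [OF Cons.prems(3) far]) (simp_all add: inner_add_left inner_Basis_nonneg)
    then show "p + r *\<^sub>R d + displacement L \<in> cbox l u" by (simp add: add.assoc)
  qed
  let ?g = "\<lambda>cs. divided_diff L (partial_derivs (cbox l u) cs f)"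
  have "((\<lambda>r. ?g cs (p + r *\<^sub>R d)) has_derivative (*) (?g (d # cs) (p + r *\<^sub>R d)))
      (at r within {0..h})" if "r \<in> {0..h}" for r
    using divided_diff_along [OF f multi_order_appendD [OF ord] hd(3), of r "{0..h}" p] mid that
    by (simp add: has_field_derivative_def)
  then have "\<exists>\<xi>\<in>{0<..<h}. ?g cs (p + h *\<^sub>R d) - ?g cs (p + 0 *\<^sub>R d)
      = ?g (d # cs) (p + \<xi> *\<^sub>R d) * (h - 0)"
    by (intro mvt_simple hd(1)) simp
  then obtain \<xi> where "\<xi> \<in> {0<..<h}"
    and eq: "?g cs (p + h *\<^sub>R d) - ?g cs p = ?g (d # cs) (p + \<xi> *\<^sub>R d) * h"
    by auto
  then have \<xi>: "\<xi> \<in> {0..h}" by simp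
  have "divided_diff (a # L) (partial_derivs (cbox l u) cs f) p = ?g (d # cs) (p + \<xi> *\<^sub>R d)"
    using hd(1) eq by (simp add: a)
  then show ?case
    using Cons.IH [OF hd(3) ord mid(1) [OF \<xi>] mid(2) [OF \<xi>]] by (simp add: a)
qed

section \<open>Difference bounds for grid functions\<close>

datatype axis = X_axis | Y_axis | Z_axis

fun next_index :: "axis \<Rightarrow> nat \<times> nat \<times> nat \<Rightarrow> nat \<times> nat \<times> nat" where
  "next_index X_axis (i, j, k) = (Suc i, j, k)"
| "next_index Y_axis (i, j, k) = (i, Suc j, k)"
| "next_index Z_axis (i, j, k) = (i, j, Suc k)"

fun grid_shift :: "axis \<Rightarrow> grid_fun \<Rightarrow> grid_fun" where
  "grid_shift X_axis v i j k = v (Suc i) j k"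
| "grid_shift Y_axis v i j k = v i (Suc j) k"
| "grid_shift Z_axis v i j k = v i j (Suc k)"

definition grid_diff :: "(axis \<Rightarrow> real) \<Rightarrow> axis \<Rightarrow> grid_fun \<Rightarrow> grid_fun" where
  "grid_diff h d v i j k = (grid_shift d v i j k - v i j k) / h d"

text \<open>
  The indices at which a forward difference of a function on \<open>A\<close> is determined by its values
  on \<open>A\<close>. Avoiding explicit ranges makes subtractions of indices unnecessary.
\<close>

definition shrink :: "axis \<Rightarrow> (nat \<times> nat \<times> nat) set \<Rightarrow> (nat \<times> nat \<times> nat) set" where
  "shrink d A = {p \<in> A. next_index d p \<in> A}"

text \<open>
  All divided differences along subsequences of the list are bounded by \<open>M\<close>: the discrete counterpart of a
  bound on mixed derivatives. The head of the list is the difference taken first, so a compact operator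
  can absorb the last entries once the earlier ones have been commuted through it.
\<close>

fun diff_bound ::
  "(axis \<Rightarrow> real) \<Rightarrow> (nat \<times> nat \<times> nat) set \<Rightarrow> axis list \<Rightarrow> real \<Rightarrow> grid_fun \<Rightarrow> bool" where
  "diff_bound h A [] M v \<longleftrightarrow> (\<forall>(i, j, k)\<in>A. \<bar>v i j k\<bar> \<le> M)"
| "diff_bound h A (d # ds) M v \<longleftrightarrow>
     diff_bound h A ds M v \<and> diff_bound h (shrink d A) ds M (grid_diff h d v)"

lemma shrink_mono: "A \<subseteq> B \<Longrightarrow> shrink d A \<subseteq> shrink d B"
  by (auto simp: shrink_def)

lemma next_index_commute: "next_index d (next_index e p) = next_index e (next_index d p)"
  by (cases p; cases d; cases e) auto

lemma shrink_commute: "shrink d (shrink e A) = shrink e (shrink d A)"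
  by (auto simp: shrink_def next_index_commute)

lemma grid_diff_shift: "grid_diff h e (grid_shift d v) = grid_shift d (grid_diff h e v)"
  by (intro ext; cases d; cases e) (auto simp: grid_diff_def)

lemma diff_bound_subset: "diff_bound h A ds M v \<Longrightarrow> B \<subseteq> A \<Longrightarrow> diff_bound h B ds M v"
proof (induction ds arbitrary: A B v)
  case (Cons d ds)
  then show ?case using shrink_mono [of B A d] by auto
qed auto

lemma diff_bound_weaken: "diff_bound h A ds M v \<Longrightarrow> M \<le> M' \<Longrightarrow> diff_bound h A ds M' v"
  by (induction ds arbitrary: A v) force+

lemma diff_bound_prefix: "diff_bound h A (ds @ es) M v \<Longrightarrow> diff_bound h A ds M v"
proof (induction ds arbitrary: A v)
  case Nil
  then show ?case by (induction es) auto
qed auto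

lemma diff_bound_shift:
  "diff_bound h A ds M v \<Longrightarrow> diff_bound h (shrink d A) ds M (grid_shift d v)"
proof (induction ds arbitrary: A v)
  case Nil
  then show ?case by (cases d) (auto simp: shrink_def)
next
  case (Cons e ds)
  then show ?case by (simp add: grid_diff_shift shrink_commute [of e])
qed

lemma diff_bound_add:
  "diff_bound h A ds M v \<Longrightarrow> diff_bound h A ds M' w \<Longrightarrow>
     diff_bound h A ds (M + M') (\<lambda>i j k. v i j k + w i j k)"
proof (induction ds arbitrary: A v w)
  case Nil
  then show ?case by (force intro: order_trans [OF abs_triangle_ineq])
next
  case (Cons d ds)
  have "grid_diff h d (\<lambda>i j k. v i j k + w i j k)
      = (\<lambda>i j k. grid_diff h d v i j k + grid_diff h d w i j k)"
    by (intro ext; cases d) (simp_all add: grid_diff_def diff_divide_distrib add_divide_distrib)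
  then show ?case using Cons by simp
qed

lemma diff_bound_scale:
  "diff_bound h A ds M v \<Longrightarrow> diff_bound h A ds (\<bar>\<alpha>\<bar> * M) (\<lambda>i j k. \<alpha> * v i j k)"
proof (induction ds arbitrary: A v)
  case Nil
  then show ?case by (force simp: abs_mult intro: mult_left_mono)
next
  case (Cons d ds)
  have "grid_diff h d (\<lambda>i j k. \<alpha> * v i j k) = (\<lambda>i j k. \<alpha> * grid_diff h d v i j k)"
    by (intro ext; cases d) (simp_all add: grid_diff_def right_diff_distrib)
  then show ?case using Cons by simp
qed

text \<open>
  The discrete Leibniz rule \<open>\<Delta>(v w) = (shift v) \<Delta>w + (\<Delta>v) w\<close> doubles the constant with every
  difference.
\<close>

lemma diff_bound_mult:
  "diff_bound h A ds M v \<Longrightarrow> diff_bound h A ds M' w \<Longrightarrow> 0 \<le> M \<Longrightarrow> 0 \<le> M' \<Longrightarrow>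
     diff_bound h A ds (2 ^ length ds * (M * M')) (\<lambda>i j k. v i j k * w i j k)"
proof (induction ds arbitrary: A v w)
  case Nil
  then show ?case by (force simp: abs_mult intro: mult_mono)
next
  case (Cons d ds)
  let ?C = "2 ^ length ds * (M * M')"
  have leibniz: "grid_diff h d (\<lambda>i j k. v i j k * w i j k)
      = (\<lambda>i j k. grid_shift d v i j k * grid_diff h d w i j k + grid_diff h d v i j k * w i j k)"
    by (intro ext; cases d) (simp_all add: grid_diff_def algebra_simps flip: add_divide_distrib diff_divide_distrib)
  have "diff_bound h (shrink d A) ds ?C (\<lambda>i j k. grid_shift d v i j k * grid_diff h d w i j k)"
    using Cons diff_bound_shift by auto
  moreover have "diff_bound h (shrink d A) ds ?C (\<lambda>i j k. grid_diff h d v i j k * w i j k)"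
  proof (rule Cons.IH)
    show "diff_bound h (shrink d A) ds M' w"
      using Cons.prems(2) by (auto intro: diff_bound_subset simp: shrink_def)
  qed (use Cons.prems in auto)
  ultimately have "diff_bound h (shrink d A) ds (?C + ?C) (grid_diff h d (\<lambda>i j k. v i j k * w i j k))"
    unfolding leibniz by (rule diff_bound_add)
  moreover have "diff_bound h A ds ?C (\<lambda>i j k. v i j k * w i j k)" using Cons by simp
  moreover have "?C \<le> ?C + ?C" using Cons.prems by simp
  ultimately show ?case using diff_bound_weaken by (fastforce simp: mult_ac)
qed

fun along :: "axis \<Rightarrow> ((nat \<Rightarrow> real) \<Rightarrow> nat \<Rightarrow> real) \<Rightarrow> grid_fun \<Rightarrow> grid_fun" where
  "along X_axis = along_x"
| "along Y_axis = along_y"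
| "along Z_axis = along_z"

fun coord :: "axis \<Rightarrow> nat \<times> nat \<times> nat \<Rightarrow> nat" where
  "coord X_axis (i, j, k) = i"
| "coord Y_axis (i, j, k) = j"
| "coord Z_axis (i, j, k) = k"

fun set_coord :: "axis \<Rightarrow> nat \<Rightarrow> nat \<times> nat \<times> nat \<Rightarrow> nat \<times> nat \<times> nat" where
  "set_coord X_axis m (i, j, k) = (m, j, k)"
| "set_coord Y_axis m (i, j, k) = (i, m, k)"
| "set_coord Z_axis m (i, j, k) = (i, j, m)"

text \<open>
  The compact operator is nonlocal: its value at one node depends on the whole grid line. Index sets
  are therefore required to contain complete lines in the direction of the operator.
\<close>

definition full_lines :: "axis \<Rightarrow> nat \<Rightarrow> (nat \<times> nat \<times> nat) set \<Rightarrow> bool" where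
  "full_lines d N A \<longleftrightarrow> (\<forall>p\<in>A. coord d p \<le> N \<and> (\<forall>m\<le>N. set_coord d m p \<in> A))"

lemma full_lines_shrink:
  assumes "full_lines d N A" and "e \<noteq> d"
  shows "full_lines d N (shrink e A)"
proof -
  have "next_index e (set_coord d m p) = set_coord d m (next_index e p)" for m p
    using assms(2) by (cases p; cases e; cases d) auto
  then show ?thesis using assms(1) by (auto simp: full_lines_def shrink_def)
qed

text \<open>
  Difference quotients across the grid lines commute with the operator along them, by linearity.
\<close>

lemma grid_diff_along:
  assumes "e \<noteq> d" and "0 < N"
  shows "grid_diff h e (along d (pade a N) v) = along d (pade a N) (grid_diff h e v)"
proof -
  have "(pade a N v m - pade a N w m) / r = pade a N (\<lambda>j. (v j - w j) / r) m" for v w r m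
    using pade_linear [OF assms(2), of a "1 / r" v "- 1 / r" w] by (simp add: diff_divide_distrib)
  then show ?thesis
    using assms(1)
    by (intro ext; cases e; cases d) (simp_all add: grid_diff_def along_x_def along_y_def along_z_def)
qed

text \<open>
  The operator along \<open>d\<close> uses up two differences in direction \<open>d\<close>; differences in the other
  directions are first commuted through it.
\<close>

lemma diff_bound_pade:
  assumes a: "end_formula a" and len: "length a \<le> N + 1" and N: "0 < N" and h: "0 < h d" and M: "0 \<le> M"
    and "d \<notin> set ds" and "full_lines d N A" and "diff_bound h A (ds @ [d, d]) M v"
  shows "diff_bound h A ds (pade_const a * (h d ^ 2 * M)) (along d (pade a N) v)"
  using assms(6-)
proof (induction ds arbitrary: A v)
  case Nil
  have second: "\<bar>central_diff2 u m\<bar> \<le> h d ^ 2 * M"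
    if m: "0 < m" and le: "\<bar>((u (Suc (Suc (m - 1))) - u (Suc (m - 1))) / h d
          - (u (Suc (m - 1)) - u (m - 1)) / h d) / h d\<bar> \<le> M" (is "\<bar>?Q\<bar> \<le> M")
    for u m
  proof -
    have "central_diff2 u m = h d ^ 2 * ?Q"
      using h m by (simp add: central_diff2_def field_simps power2_eq_square)
    then have "\<bar>central_diff2 u m\<bar> = h d ^ 2 * \<bar>?Q\<bar>" by (simp only: abs_mult abs_power2)
    then show ?thesis using le by (simp only: mult_left_mono zero_le_power2)
  qed
  have B: "0 \<le> h d ^ 2 * M" using M by simp
  have two: "\<bar>grid_diff h d (grid_diff h d v) i j k\<bar> \<le> M"
    if "(i, j, k) \<in> A" "coord d (i, j, k) + 2 \<le> N" for i j k
  proof -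
    have "next_index d (i, j, k) \<in> A" "next_index d (next_index d (i, j, k)) \<in> A"
      using Nil(2) that unfolding full_lines_def by (cases d; force)+
    then have "(i, j, k) \<in> shrink d (shrink d A)" using that by (simp add: shrink_def)
    then show ?thesis using Nil(3) by auto
  qed
  show ?case
    unfolding diff_bound.simps
  proof (clarify)
    fix i j k assume p: "(i, j, k) \<in> A"
    have line: "set_coord d m (i, j, k) \<in> A" if "m \<le> N" for m
      using Nil(2) p that unfolding full_lines_def by blast
    have c: "coord d (i, j, k) \<le> N" using Nil(2) p unfolding full_lines_def by blast
    show "\<bar>along d (pade a N) v i j k\<bar> \<le> pade_const a * (h d ^ 2 * M)"
    proof (cases d)
      case X_axis
      have "\<bar>central_diff2 (\<lambda>i. v i j k) m\<bar> \<le> h d ^ 2 * M" if "0 < m" "m < N" for m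
        using two [of "m - 1" j k] line [of "m - 1"] that
        by (intro second) (auto simp: X_axis grid_diff_def)
      then show ?thesis using pade_stable [OF a len N B c] by (simp add: X_axis along_x_def)
    next
      case Y_axis
      have "\<bar>central_diff2 (\<lambda>j. v i j k) m\<bar> \<le> h d ^ 2 * M" if "0 < m" "m < N" for m
        using two [of i "m - 1" k] line [of "m - 1"] that
        by (intro second) (auto simp: Y_axis grid_diff_def)
      then show ?thesis using pade_stable [OF a len N B c] by (simp add: Y_axis along_y_def)
    next
      case Z_axis
      have "\<bar>central_diff2 (\<lambda>k. v i j k) m\<bar> \<le> h d ^ 2 * M" if "0 < m" "m < N" for m
        using two [of i j "m - 1"] line [of "m - 1"] that
        by (intro second) (auto simp: Z_axis grid_diff_def)
      then show ?thesis using pade_stable [OF a len N B c] by (simp add: Z_axis along_z_def)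
    qed
  qed
next
  case (Cons e ds)
  then have "e \<noteq> d" by auto
  then show ?case
    using Cons full_lines_shrink by (simp add: grid_diff_along [OF _ N])
qed

definition grid_node :: "'a::real_vector \<Rightarrow> (axis \<Rightarrow> real) \<Rightarrow> (axis \<Rightarrow> 'a) \<Rightarrow> nat \<Rightarrow> nat \<Rightarrow> nat \<Rightarrow> 'a" where
  "grid_node p0 h e i j k = p0 + (real i * h X_axis) *\<^sub>R e X_axis + (real j * h Y_axis) *\<^sub>R e Y_axis
     + (real k * h Z_axis) *\<^sub>R e Z_axis"

text \<open>
  The list \<open>L\<close> holds quotients already formed: each grid difference in the induction is moved
  into it, and \<open>divided_diff_mean_value\<close> handles the complete list at the end. Starting from
  nonempty \<open>L\<close> yields bounds for quotients in directions, such as time, that are not grid axes.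
\<close>

lemma diff_bound_divided_diff:
  assumes f: "C_each_variable m (cbox l u) f"
    and M: "\<And>bs p. multi_order m bs \<Longrightarrow> p \<in> cbox l u \<Longrightarrow> \<bar>partial_derivs (cbox l u) bs f p\<bar> \<le> M"
    and h: "\<And>d. 0 < h d" and e: "\<And>d. e d \<in> Basis"
    and "forward_steps L" and "multi_order m (map e ds @ map snd L)"
    and "\<And>i j k. (i, j, k) \<in> A \<Longrightarrow> grid_node p0 h e i j k \<in> cbox l u
           \<and> grid_node p0 h e i j k + displacement L \<in> cbox l u"
  shows "diff_bound h A ds M (\<lambda>i j k. divided_diff L f (grid_node p0 h e i j k))"
  using assms(5-)
proof (induction ds arbitrary: A L)
  case Nil
  show ?case
    unfolding diff_bound.simps
  proof clarify
    fix i j k assume "(i, j, k) \<in> A"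
    then have "grid_node p0 h e i j k \<in> cbox l u"
      "grid_node p0 h e i j k + displacement L \<in> cbox l u"
      using Nil(3) by blast+
    from divided_diff_mean_value [OF f Nil(1) _ this, of "[]"]
    obtain q where "q \<in> cbox l u"
      "divided_diff L (partial_derivs (cbox l u) [] f) (grid_node p0 h e i j k)
        = partial_derivs (cbox l u) (rev (map snd L)) f q"
      using Nil(2) by auto
    moreover have "multi_order m (rev (map snd L))" using Nil(2) by (simp add: multi_order_def)
    ultimately show "\<bar>divided_diff L f (grid_node p0 h e i j k)\<bar> \<le> M"
      using M by (simp add: partial_derivs_def)
  qed
next
  case (Cons d ds)
  have "grid_diff h d (\<lambda>i j k. divided_diff L f (grid_node p0 h e i j k))
      = (\<lambda>i j k. divided_diff ((h d, e d) # L) f (grid_node p0 h e i j k))"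
    by (intro ext; cases d) (simp_all add: grid_diff_def grid_node_def algebra_simps)
  moreover have "diff_bound h (shrink d A) ds M (\<lambda>i j k. divided_diff ((h d, e d) # L) f (grid_node p0 h e i j k))"
  proof (rule Cons.IH)
    show "multi_order m (map e ds @ map snd ((h d, e d) # L))"
      using Cons.prems(2) by (auto simp: multi_order_def split: if_splits)
    fix i j k assume p: "(i, j, k) \<in> shrink d A"
    obtain i' j' k' where p': "next_index d (i, j, k) = (i', j', k')" by (metis prod_cases3)
    then have "(i', j', k') \<in> A" "(i, j, k) \<in> A" using p by (auto simp: shrink_def)
    moreover have "grid_node p0 h e i' j' k' = grid_node p0 h e i j k + h d *\<^sub>R e d"
      using p' by (cases d) (auto simp: grid_node_def algebra_simps)
    ultimately show "grid_node p0 h e i j k \<in> cbox l u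
           \<and> grid_node p0 h e i j k + displacement ((h d, e d) # L) \<in> cbox l u"
      using Cons.prems(3) by (fastforce simp: add.assoc)
  qed (use h e Cons.prems(1) in simp)
  moreover have "diff_bound h A ds M (\<lambda>i j k. divided_diff L f (grid_node p0 h e i j k))"
    using multi_order_ConsD [of m "e d"] Cons by simp
  ultimately show ?case by simp
qed

section \<open>Consistency of the compact operator and of the time difference\<close>

text \<open>
  Unfolded on a concrete list, \<^const>\<open>diff_bound\<close> splits into exponentially many conjuncts.
\<close>

declare diff_bound.simps [simp del] along.simps [simp del]

lemma deriv_tower_along:
  assumes f: "C_each_variable m S f" and b: "b \<in> Basis"
    and M: "\<And>bs p. multi_order m bs \<Longrightarrow> p \<in> S \<Longrightarrow> \<bar>partial_derivs S bs f p\<bar> \<le> M"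
    and I: "\<And>r. r \<in> I \<Longrightarrow> p + r *\<^sub>R b \<in> S"
  shows "deriv_tower m (\<lambda>i r. partial_derivs S (replicate i b) f (p + r *\<^sub>R b)) I M"
proof -
  have ord: "multi_order m (replicate i b)" if "i \<le> m" for i
  proof -
    have "count_list (replicate i b) c \<le> i" for c :: 'a by (induction i) auto
    then show ?thesis using b that by (auto simp: multi_order_def intro: order_trans)
  qed
  show ?thesis
    unfolding deriv_tower_def
  proof (intro conjI allI impI ballI)
    fix i r assume i: "i < m" and r: "r \<in> I"
    have "multi_order m (b # replicate i b)" using ord [of "Suc i"] i by simp
    from partial_derivs_along [OF f this I r]
    show "((\<lambda>r. partial_derivs S (replicate i b) f (p + r *\<^sub>R b)) has_real_derivative
        partial_derivs S (replicate (Suc i) b) f (p + r *\<^sub>R b)) (at r within I)" by simp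
  next
    fix r assume "r \<in> I"
    then show "\<bar>partial_derivs S (replicate m b) f (p + r *\<^sub>R b)\<bar> \<le> M" using M ord I by blast
  qed
qed

lemma pade_partial_derivs:
  assumes f: "C_each_variable 6 S f" and b: "b \<in> Basis"
    and M: "\<And>bs p. multi_order 6 bs \<Longrightarrow> p \<in> S \<Longrightarrow> \<bar>partial_derivs S bs f p\<bar> \<le> M"
    and a: "end_formula a" "length a \<le> N + 1" "0 < N" "i \<le> N" and h: "0 < h"
    and line: "\<And>r. 0 \<le> r \<Longrightarrow> r \<le> real N * h \<Longrightarrow> p + r *\<^sub>R b \<in> S"
  shows "\<bar>pade a N (\<lambda>j. f (p + (real j * h) *\<^sub>R b)) i / h\<^sup>2
            - partial_derivs S [b, b] f (p + (real i * h) *\<^sub>R b)\<bar> \<le> pade_const a * M * h ^ 4"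
proof -
  have "deriv_tower 6 (\<lambda>i r. partial_derivs S (replicate i b) f (p + r *\<^sub>R b)) {0..0 + real N * h} M"
    using line by (intro deriv_tower_along [OF f b M]) auto
  from pade_fourth_order [OF a h this]
  have *: "\<bar>pade a N (\<lambda>j. f (p + (real j * h) *\<^sub>R b)) i
            - h\<^sup>2 * partial_derivs S [b, b] f (p + (real i * h) *\<^sub>R b)\<bar> \<le> pade_const a * (M * h ^ 6)"
    by (simp add: partial_derivs_def numeral_2_eq_2)
  define w where "w = pade a N (\<lambda>j. f (p + (real j * h) *\<^sub>R b)) i"
  define g where "g = partial_derivs S [b, b] f (p + (real i * h) *\<^sub>R b)"
  have "w / h\<^sup>2 - g = (w - h\<^sup>2 * g) / h\<^sup>2" using h by (simp add: field_simps)
  then have "\<bar>w / h\<^sup>2 - g\<bar> = \<bar>w - h\<^sup>2 * g\<bar> / h\<^sup>2" by simp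
  also have "\<dots> \<le> pade_const a * (M * h ^ 6) / h\<^sup>2"
    using * by (intro divide_right_mono) (simp_all add: w_def g_def)
  also have "\<dots> = pade_const a * M * h ^ 4"
    using h by (simp add: field_simps flip: power_add)
  finally show ?thesis by (simp add: w_def g_def)
qed

lemma three_point_partial_derivs:
  assumes f: "C_each_variable 6 S f" and b: "b \<in> Basis"
    and M: "\<And>bs p. multi_order 6 bs \<Longrightarrow> p \<in> S \<Longrightarrow> \<bar>partial_derivs S bs f p\<bar> \<le> M"
    and h: "0 < h" and line: "\<And>r. 0 \<le> r \<Longrightarrow> r \<le> 2 * h \<Longrightarrow> p + r *\<^sub>R b \<in> S"
  shows "\<bar>f p - 2 * f (p + h *\<^sub>R b) + f (p + (2 * h) *\<^sub>R b)
      - h\<^sup>2 * (partial_derivs S [b, b] f (p + h *\<^sub>R b)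
               + (partial_derivs S [b, b] f p - 2 * partial_derivs S [b, b] f (p + h *\<^sub>R b)
                  + partial_derivs S [b, b] f (p + (2 * h) *\<^sub>R b)) / 12)\<bar> \<le> M * h ^ 6"
proof -
  have "deriv_tower 6 (\<lambda>i r. partial_derivs S (replicate i b) f (p + r *\<^sub>R b)) {0..2 * h} M"
    using line by (intro deriv_tower_along [OF f b M]) auto
  from three_point_fourth_order [OF this h, of h] show ?thesis
    by (simp add: partial_derivs_def numeral_2_eq_2 flip: mult_2)
qed

section \<open>The product of the three factors\<close>

definition adi_term :: "real \<Rightarrow> grid_fun \<Rightarrow> (grid_fun \<Rightarrow> grid_fun) \<Rightarrow> grid_fun \<Rightarrow> grid_fun" where
  "adi_term lam c P v i j k = lam / 12 * (c i j k * P v i j k)"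

lemma adi_factor_eq: "adi_factor lam c P v = (\<lambda>i j k. v i j k - adi_term lam c P v i j k)"
  by (intro ext) (simp add: adi_factor_def adi_term_def)

lemma along_pade_diff:
  assumes "0 < N"
  shows "along d (pade a N) (\<lambda>i j k. v i j k - w i j k)
    = (\<lambda>i j k. along d (pade a N) v i j k - along d (pade a N) w i j k)"
proof -
  have "pade a N (\<lambda>j. v j - w j) = (\<lambda>j. pade a N v j - pade a N w j)" for v w
    using pade_linear [OF assms, of a 1 v "- 1" w] by simp
  then show ?thesis
    by (intro ext; cases d) (simp_all add: along.simps along_x_def along_y_def along_z_def)
qed

lemma adi_term_diff:
  assumes "0 < N"
  shows "adi_term lam c (along d (pade a N)) (\<lambda>i j k. v i j k - w i j k) i j k
    = adi_term lam c (along d (pade a N)) v i j k - adi_term lam c (along d (pade a N)) w i j k"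
  by (simp add: adi_term_def along_pade_diff [OF assms] algebra_simps)

text \<open>
  The factor \<open>1/h\<^sup>2\<close> meets the \<open>h\<^sup>2\<close> of the stability bound, so only \<open>\<tau>\<^sup>2\<close> survives. The
  constant \<open>2\<close> rounds up \<open>2\<^sup>4/12\<close>, which combines the Leibniz rule for at most four differences
  with the factor \<open>1/12\<close> of the bracket.
\<close>

lemma adi_term_bound:
  assumes pade: "end_formula a" "length a \<le> N + 1" "0 < N" "0 < h d" "pade_const a \<le> C"
    and ds: "d \<notin> set ds" "length ds \<le> 4" and A: "full_lines d N A"
    and c: "diff_bound h A ds Mc c" "0 \<le> Mc"
    and v: "diff_bound h A (ds @ [d, d]) M v" "0 \<le> M"
  shows "diff_bound h A ds (\<tau>\<^sup>2 * (2 * Mc * C) * M)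
           (adi_term (\<tau>\<^sup>2 / (h d)\<^sup>2) c (along d (pade a N)) v)"
proof -
  let ?B = "pade_const a * ((h d)\<^sup>2 * M)"
  have C: "0 \<le> pade_const a" using pade_const_pos [of a] by simp
  have B: "0 \<le> ?B" using C v(2) by simp
  have "diff_bound h A ds ?B (along d (pade a N) v)"
    using pade(1-4) v(2) ds(1) A v(1) by (rule diff_bound_pade)
  from diff_bound_mult [OF c(1) this c(2) B]
  have "diff_bound h A ds (\<bar>\<tau>\<^sup>2 / (h d)\<^sup>2 / 12\<bar> * (2 ^ length ds * (Mc * ?B)))
      (\<lambda>i j k. \<tau>\<^sup>2 / (h d)\<^sup>2 / 12 * (c i j k * along d (pade a N) v i j k))"
    by (rule diff_bound_scale)
  moreover have "\<bar>\<tau>\<^sup>2 / (h d)\<^sup>2 / 12\<bar> * (2 ^ length ds * (Mc * ?B)) \<le> \<tau>\<^sup>2 * (2 * Mc * C) * M"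
  proof -
    have "(2 :: real) ^ length ds \<le> 2 ^ 4" using ds(2) by (intro power_increasing) auto
    then have two: "(2 :: real) ^ length ds \<le> 16" by simp
    have "\<bar>\<tau>\<^sup>2 / (h d)\<^sup>2 / 12\<bar> * (2 ^ length ds * (Mc * ?B))
        = 2 ^ length ds * (\<tau>\<^sup>2 * Mc * pade_const a * M) / 12"
      using pade(4) by simp
    also have "\<dots> \<le> 24 * (\<tau>\<^sup>2 * Mc * C * M) / 12"
      using two pade(5) C c(2) v(2) by (intro divide_right_mono mult_mono) auto
    finally show ?thesis by (simp add: mult_ac)
  qed
  ultimately show ?thesis
    unfolding adi_term_def [abs_def] by (rule diff_bound_weaken)
qed

text \<open>
  With \<open>z = v - Q\<^sub>z v\<close> the product of the brackets is
  \<open>v - Q\<^sub>x v - Q\<^sub>y v - Q\<^sub>z v + Q\<^sub>y Q\<^sub>z v + Q\<^sub>x Q\<^sub>z v + Q\<^sub>x Q\<^sub>y z\<close>. Two differences of the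
  coefficient \<open>c\<close> in \<open>x\<close> and \<open>y\<close> are needed because it stands to the right of another
  operator in these products.
\<close>

lemma adi_cross_terms:
  fixes h :: "axis \<Rightarrow> real" and N :: "axis \<Rightarrow> nat" and a :: "axis \<Rightarrow> real list"
    and \<tau> :: real and c :: grid_fun
  defines "A \<equiv> {(i, j, k). i \<le> N X_axis \<and> j \<le> N Y_axis \<and> k \<le> N Z_axis}"
    and "Q \<equiv> \<lambda>d. adi_term (\<tau>\<^sup>2 / (h d)\<^sup>2) c (along d (pade (a d) (N d)))"
  assumes pade: "\<And>d. end_formula (a d)" "\<And>d. length (a d) \<le> N d + 1" "\<And>d. 0 < N d"
      "\<And>d. 0 < h d" "\<And>d. pade_const (a d) \<le> C"
    and c: "diff_bound h A [X_axis, X_axis, Y_axis, Y_axis] Mc c" "0 \<le> Mc"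
    and v: "diff_bound h A [X_axis, X_axis, Y_axis, Y_axis, Z_axis, Z_axis] M v" "0 \<le> M"
    and p: "(i, j, k) \<in> A"
  shows "\<bar>adi_factor (\<tau>\<^sup>2 / (h X_axis)\<^sup>2) c (along X_axis (pade (a X_axis) (N X_axis)))
           (adi_factor (\<tau>\<^sup>2 / (h Y_axis)\<^sup>2) c (along Y_axis (pade (a Y_axis) (N Y_axis)))
             (adi_factor (\<tau>\<^sup>2 / (h Z_axis)\<^sup>2) c (along Z_axis (pade (a Z_axis) (N Z_axis))) v)) i j k
           - (v i j k - Q X_axis v i j k - Q Y_axis v i j k - Q Z_axis v i j k)\<bar>
         \<le> (\<tau>\<^sup>2 * (2 * Mc * C))\<^sup>2 * (3 + \<tau>\<^sup>2 * (2 * Mc * C)) * M"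
proof -
  let ?L = "\<tau>\<^sup>2 * (2 * Mc * C)"
  have "0 < C" using pade(5) [of X_axis] pade_const_pos [of "a X_axis"] by linarith
  then have L: "0 \<le> ?L" using c(2) by simp
  have full: "full_lines d (N d) A" for d by (cases d) (auto simp: full_lines_def A_def)
  have Q: "diff_bound h A ds (?L * B) (Q d w)"
    if "diff_bound h A (ds @ [d, d]) B w" "diff_bound h A ds Mc c" "d \<notin> set ds" "length ds \<le> 4" "0 \<le> B"
    for d ds B w
    unfolding Q_def
    using adi_term_bound [OF pade(1,2,3,4,5) that(3,4) full that(2) c(2) that(1,5)] .
  let ?x = "[X_axis, X_axis]" and ?xy = "[X_axis, X_axis, Y_axis, Y_axis]"
  define z where "z = (\<lambda>i j k. v i j k - Q Z_axis v i j k)"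
  have Qdiff: "Q d (\<lambda>i j k. v i j k - w i j k) = (\<lambda>i j k. Q d v i j k - Q d w i j k)" for d v w
    unfolding Q_def by (intro ext adi_term_diff pade(3))
  have cx: "diff_bound h A ?x Mc c" and c0: "diff_bound h A [] Mc c"
    using diff_bound_prefix [of h A ?x "[Y_axis, Y_axis]"] diff_bound_prefix [of h A "[]"] c(1)
    by simp_all
  have Qz: "diff_bound h A ?xy (?L * M) (Q Z_axis v)"
    by (rule Q) (use v c(1) in simp_all)
  have Qzx: "diff_bound h A ?x (?L * M) (Q Z_axis v)"
    using diff_bound_prefix [of h A ?x "[Y_axis, Y_axis]"] Qz by simp
  have "diff_bound h A ?xy (M + \<bar>- 1\<bar> * (?L * M)) (\<lambda>i j k. v i j k + - 1 * Q Z_axis v i j k)"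
    using diff_bound_prefix [of h A ?xy "[Z_axis, Z_axis]"] v(1)
    by (intro diff_bound_add diff_bound_scale Qz) simp
  then have z: "diff_bound h A ?xy (M + ?L * M) z" by (simp add: z_def)
  have LM: "0 \<le> ?L * M" "0 \<le> ?L * (M + ?L * M)" "0 \<le> M + ?L * M" using L v(2) by simp_all
  have "diff_bound h A ?x (?L * (?L * M)) (Q Y_axis (Q Z_axis v))"
    by (rule Q) (use Qz cx LM(1) in simp_all)
  then have Qyz: "diff_bound h A [] (?L * (?L * M)) (Q Y_axis (Q Z_axis v))"
    using diff_bound_prefix [of h A "[]"] by simp
  have Qxz: "diff_bound h A [] (?L * (?L * M)) (Q X_axis (Q Z_axis v))"
    by (rule Q) (use Qzx c0 LM(1) in simp_all)
  have Qyz': "diff_bound h A ?x (?L * (M + ?L * M)) (Q Y_axis z)"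
    by (rule Q) (use z cx LM(3) in simp_all)
  have Qxyz: "diff_bound h A [] (?L * (?L * (M + ?L * M))) (Q X_axis (Q Y_axis z))"
    by (rule Q) (use Qyz' c0 LM(2) in simp_all)
  have "adi_factor (\<tau>\<^sup>2 / (h X_axis)\<^sup>2) c (along X_axis (pade (a X_axis) (N X_axis)))
           (adi_factor (\<tau>\<^sup>2 / (h Y_axis)\<^sup>2) c (along Y_axis (pade (a Y_axis) (N Y_axis)))
             (adi_factor (\<tau>\<^sup>2 / (h Z_axis)\<^sup>2) c (along Z_axis (pade (a Z_axis) (N Z_axis))) v)) i j k
           - (v i j k - Q X_axis v i j k - Q Y_axis v i j k - Q Z_axis v i j k)
     = Q Y_axis (Q Z_axis v) i j k + Q X_axis (Q Z_axis v) i j k + Q X_axis (Q Y_axis z) i j k"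
  proof -
    have fac: "adi_factor (\<tau>\<^sup>2 / (h d)\<^sup>2) c (along d (pade (a d) (N d))) w
        = (\<lambda>i j k. w i j k - Q d w i j k)" for d w
      by (simp add: adi_factor_eq Q_def)
    show ?thesis unfolding fac z_def Qdiff by simp
  qed
  also have "\<bar>\<dots>\<bar> \<le> \<bar>Q Y_axis (Q Z_axis v) i j k\<bar> + \<bar>Q X_axis (Q Z_axis v) i j k\<bar>
      + \<bar>Q X_axis (Q Y_axis z) i j k\<bar>"
    by (rule order_trans [OF abs_triangle_ineq add_right_mono [OF abs_triangle_ineq]])
  also have "\<dots> \<le> ?L * (?L * M) + ?L * (?L * M) + ?L * (?L * (M + ?L * M))"
    using Qyz Qxz Qxyz p by (intro add_mono) (auto simp only: diff_bound.simps)
  also have "?L * (?L * M) + ?L * (?L * M) + ?L * (?L * (M + ?L * M)) = ?L\<^sup>2 * (3 + ?L) * M"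
  proof -
    have "l * (l * M) + l * (l * M) + l * (l * (M + l * M)) = l\<^sup>2 * (3 + l) * M" for l
      by (simp add: power2_eq_square algebra_simps)
    then show ?thesis .
  qed
  finally show ?thesis .
qed

text \<open>
  The bracket terms \<open>\<tau>\<^sup>2/12 c P \<delta>\<^sub>t\<^sup>2 u\<close> and the part \<open>\<tau>\<^sup>2/12 c \<delta>\<^sub>t\<^sup>2 \<Delta>u\<close> of the source
  term cancel up to \<open>\<delta>\<^sub>t\<^sup>2\<close> of the spatial error. Here \<open>R\<close> collects the cross terms, and
  \<open>ex\<close>, \<open>ey\<close>, \<open>ez\<close> are the spatial errors at one node as functions of the time level.
\<close>

lemma adi_residual_splitting:
  fixes \<tau> hx hy hz c :: real
  assumes "\<tau> \<noteq> 0"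
    and s: "\<And>m. m \<in> {n - 1, n, n + 1} \<Longrightarrow> s m = utt m - c * (xx m + yy m + zz m)" 
    and px: "\<And>m. px m = hx\<^sup>2 * (xx m + ex m)" and py: "\<And>m. py m = hy\<^sup>2 * (yy m + ey m)"
    and pz: "\<And>m. pz m = hz\<^sup>2 * (zz m + ez m)"
    and "hx \<noteq> 0" "hy \<noteq> 0" "hz \<noteq> 0"
    and lhs: "lhs = V - \<tau>\<^sup>2 / hx\<^sup>2 / 12 * (c * central_diff2 px n)
       - \<tau>\<^sup>2 / hy\<^sup>2 / 12 * (c * central_diff2 py n) - \<tau>\<^sup>2 / hz\<^sup>2 / 12 * (c * central_diff2 pz n) + R"
  shows "(lhs - (c * (\<tau>\<^sup>2 / hx\<^sup>2 * px n + \<tau>\<^sup>2 / hy\<^sup>2 * py n + \<tau>\<^sup>2 / hz\<^sup>2 * pz n)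
            + \<tau>\<^sup>2 * (s n + central_diff2 s n / 12))) / \<tau>\<^sup>2
     = (V - \<tau>\<^sup>2 * (utt n + central_diff2 utt n / 12)) / \<tau>\<^sup>2 + R / \<tau>\<^sup>2
       - c * ((ex n + central_diff2 ex n / 12) + (ey n + central_diff2 ey n / 12)
              + (ez n + central_diff2 ez n / 12))"
proof -
  have s3: "s (n - 1) = utt (n - 1) - c * (xx (n - 1) + yy (n - 1) + zz (n - 1))"
    "s n = utt n - c * (xx n + yy n + zz n)"
    "s (n + 1) = utt (n + 1) - c * (xx (n + 1) + yy (n + 1) + zz (n + 1))"
    using s by simp_all
  show ?thesis
    unfolding lhs central_diff2_def s3 px py pz using assms(1,6-8) by (simp add: field_simps)
qed

lemma central_diff2_perturbation:
  assumes "\<And>m. m \<in> {n - 1, n, n + 1} \<Longrightarrow> \<bar>e m\<bar> \<le> B"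
  shows "\<bar>e n + central_diff2 e n / 12\<bar> \<le> 4 / 3 * B"
proof -
  have "\<bar>x + (l - 2 * x + r) / 12\<bar> \<le> 4 / 3 * B"
    if "\<bar>x\<bar> \<le> B" "\<bar>l\<bar> \<le> B" "\<bar>r\<bar> \<le> B" for x l r :: real
    using that by argo
  then show ?thesis using assms unfolding central_diff2_def by simp
qed

section \<open>The truncation error\<close>

theorem theorem3p2:
  fixes x0 x1 y0 y1 z0 z1 T :: real
    and \<nu> c f1 f2 :: "real \<times> real \<times> real \<Rightarrow> real"
    and s g u :: "(real \<times> real \<times> real) \<times> real \<Rightarrow> real"
    and ax ay az :: "real list"
    and \<Omega> :: "(real \<times> real \<times> real) set"
  assumes "x0 < x1" and "y0 < y1" and "z0 < z1" and "0 < T"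
    and "\<Omega> = {x0..x1} \<times> {y0..y1} \<times> {z0..z1}"
    and "\<forall>p\<in>\<Omega>. c p = (\<nu> p)\<^sup>2"
    and "C_each_variable 2 \<Omega> c"
    and "C_each_variable 6 (\<Omega> \<times> {0..T}) u"
    and "acoustic_solution \<Omega> T c s f1 f2 g u"
    and "end_formula ax" and "end_formula ay" and "end_formula az"
  shows "\<exists>K. \<forall>\<tau> Nx Ny Nz n i j k.
    0 < \<tau> \<and> length ax \<le> Nx + 1 \<and> length ay \<le> Ny + 1 \<and> length az \<le> Nz + 1 \<and>
    0 < n \<and> real (n + 1) * \<tau> \<le> T \<and>
    0 < i \<and> i < Nx \<and> 0 < j \<and> j < Ny \<and> 0 < k \<and> k < Nz \<longrightarrow>
    (let hx = (x1 - x0) / real Nx; hy = (y1 - y0) / real Ny; hz = (z1 - z0) / real Nz;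
         node = (\<lambda>i j k. (x0 + real i * hx, y0 + real j * hy, z0 + real k * hz))
     in \<bar>adi_residual \<tau> hx hy hz
           (along_x (pade ax Nx)) (along_y (pade ay Ny)) (along_z (pade az Nz))
           (\<lambda>i j k. c (node i j k))
           (\<lambda>n i j k. u (node i j k, real n * \<tau>))
           (\<lambda>n i j k. s (node i j k, real n * \<tau>)) n i j k\<bar>
        \<le> K * (\<tau> ^ 4 + hx ^ 4 + hy ^ 4 + hz ^ 4))"
proof -
  note order = assms(1-3) and tT = assms(4) and \<Omega> = assms(5)
    and c2 = assms(7) and u6 = assms(8) and sol = assms(9)
  define S where "S = \<Omega> \<times> {0..T}"
  have boxc: "\<Omega> = cbox (x0, y0, z0) (x1, y1, z1)"
    by (simp add: \<Omega> cbox_Pair_eq)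
  have boxu: "S = cbox ((x0, y0, z0), 0) ((x1, y1, z1), T)"
    by (simp add: S_def boxc cbox_Pair_eq)
  have memS: "((x, y, z), t) \<in> S \<longleftrightarrow>
      x0 \<le> x \<and> x \<le> x1 \<and> y0 \<le> y \<and> y \<le> y1 \<and> z0 \<le> z \<and> z \<le> z1 \<and> 0 \<le> t \<and> t \<le> T" for x y z t
    by (auto simp: S_def \<Omega>)
  have memO: "(x, y, z) \<in> \<Omega> \<longleftrightarrow>
      x0 \<le> x \<and> x \<le> x1 \<and> y0 \<le> y \<and> y \<le> y1 \<and> z0 \<le> z \<and> z \<le> z1" for x y z
    by (auto simp: \<Omega>)
  have u6': "C_each_variable 6 S u" using u6 by (simp add: S_def)
  obtain Mc where Mc: "0 \<le> Mc"
    and c_bd: "\<And>bs p. multi_order 2 bs \<Longrightarrow> p \<in> \<Omega> \<Longrightarrow> \<bar>partial_derivs \<Omega> bs c p\<bar> \<le> Mc"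
    using C_each_variable_bound [OF c2] by blast
  obtain Mu where Mu: "0 \<le> Mu"
    and u_bd: "\<And>bs p. multi_order 6 bs \<Longrightarrow> p \<in> S \<Longrightarrow> \<bar>partial_derivs S bs u p\<bar> \<le> Mu"
    using C_each_variable_bound [OF u6'] by blast
  have dirs: "dir_x \<in> Basis" "dir_y \<in> Basis" "dir_z \<in> Basis" "dir_t \<in> Basis"
    by (simp_all add: dir_x_def dir_y_def dir_z_def dir_t_def Basis_prod_def zero_prod_def)
  define ec :: "axis \<Rightarrow> real \<times> real \<times> real"
    where "ec = case_axis (1, 0, 0) (0, 1, 0) (0, 0, 1)"
  define eu where "eu = case_axis dir_x dir_y dir_z"
  have ec: "ec d \<in> Basis" for d
    by (cases d) (simp_all add: ec_def Basis_prod_def zero_prod_def)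
  have eu: "eu d \<in> Basis" for d by (cases d) (simp_all add: eu_def dirs)
  define a where "a = case_axis ax ay az"
  define C where "C = pade_const ax + pade_const ay + pade_const az"
  have C: "pade_const (a d) \<le> C" for d
    using pade_const_pos [of ax] pade_const_pos [of ay] pade_const_pos [of az]
    by (cases d) (simp_all add: a_def C_def)
  have C0: "0 \<le> C" using C [of X_axis] pade_const_pos [of "a X_axis"] by linarith
  define L where "L = 2 * Mc * C"
  have L: "0 \<le> L" using Mc C0 by (simp add: L_def)
  \<comment> \<open>The three summands bound the error in time, the errors in space and the cross terms.\<close>
  define K where "K = Mu + Mc * (4 / 3 * (C * Mu)) + L\<^sup>2 * (3 + T\<^sup>2 * L) * Mu"
  let ?utt = "partial_derivs S [dir_t, dir_t] u"
  let ?uxx = "partial_derivs S [dir_x, dir_x] u"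
  let ?uyy = "partial_derivs S [dir_y, dir_y] u"
  let ?uzz = "partial_derivs S [dir_z, dir_z] u"
  have main: "\<bar>adi_residual \<tau> hx hy hz
           (along_x (pade ax Nx)) (along_y (pade ay Ny)) (along_z (pade az Nz))
           (\<lambda>i j k. c (node i j k))
           (\<lambda>n i j k. u (node i j k, real n * \<tau>))
           (\<lambda>n i j k. s (node i j k, real n * \<tau>)) n i j k\<bar>
        \<le> K * (\<tau> ^ 4 + hx ^ 4 + hy ^ 4 + hz ^ 4)"
    if \<tau>: "0 < \<tau>" and len: "length ax \<le> Nx + 1" "length ay \<le> Ny + 1" "length az \<le> Nz + 1"
      and n: "0 < n" "real (n + 1) * \<tau> \<le> T"
      and i: "0 < i" "i < Nx" and j: "0 < j" "j < Ny" and k: "0 < k" "k < Nz"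
      and hx: "hx = (x1 - x0) / real Nx" and hy: "hy = (y1 - y0) / real Ny"
      and hz: "hz = (z1 - z0) / real Nz"
      and node: "node = (\<lambda>i j k. (x0 + real i * hx, y0 + real j * hy, z0 + real k * hz))"
    for \<tau> hx hy hz :: real and Nx Ny Nz n i j k and node
  proof -
    define h where "h = case_axis hx hy hz"
    define N where "N = case_axis Nx Ny Nz"
    define A where "A = {(i, j, k). i \<le> N X_axis \<and> j \<le> N Y_axis \<and> k \<le> N Z_axis}"
    have hpos: "0 < hx" "0 < hy" "0 < hz" using order i j k by (simp_all add: hx hy hz)
    have ends: "real Nx * hx = x1 - x0" "real Ny * hy = y1 - y0" "real Nz * hz = z1 - z0"
      using i j k by (simp_all add: hx hy hz)
    have h: "0 < h d" for d using hpos by (cases d) (simp_all add: h_def)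
    have N: "0 < N d" for d using i j k by (cases d) (simp_all add: N_def)
    have alen: "length (a d) \<le> N d + 1" for d using len by (cases d) (simp_all add: a_def N_def)
    have aend: "end_formula (a d)" for d using assms(10-12) by (cases d) (simp_all add: a_def)
    have in_line: "0 \<le> real m * r" "real m * r \<le> real M * r" if "m \<le> M" "0 < r" for m M and r :: real
      using that by (simp_all add: mult_right_mono)
    have nodeO: "node i j k \<in> \<Omega>" if "(i, j, k) \<in> A" for i j k
      using that in_line [of i Nx hx] in_line [of j Ny hy] in_line [of k Nz hz] hpos ends
      by (simp add: node memO A_def N_def)
    have p: "(i, j, k) \<in> A" using i j k by (simp add: A_def N_def)
    have times: "0 \<le> real m * \<tau>" "real m * \<tau> \<le> T" if "m \<in> {n - 1, n, n + 1}" for m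
    proof -
      have "m \<le> n + 1" using that by auto
      then show "0 \<le> real m * \<tau>" "real m * \<tau> \<le> T"
        using in_line [of m "n + 1" \<tau>] \<tau> order_trans [OF _ n(2)] by blast+
    qed
    have nodec: "grid_node (x0, y0, z0) h ec i j k = node i j k" for i j k
      by (simp add: grid_node_def h_def ec_def node)
    have nodeu: "grid_node ((x0, y0, z0), t) h eu i j k = (node i j k, t)" for i j k t
      by (simp add: grid_node_def h_def eu_def node dir_x_def dir_y_def dir_z_def)
    define cg where "cg = (\<lambda>i j k. c (node i j k))"
    define V where "V = delta_t2 (\<lambda>n i j k. u (node i j k, real n * \<tau>)) n"

    have c_bound: "diff_bound h A [X_axis, X_axis, Y_axis, Y_axis] Mc cg"
    proof -
      have "diff_bound h A [X_axis, X_axis, Y_axis, Y_axis] Mc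
          (\<lambda>i j k. divided_diff [] c (grid_node (x0, y0, z0) h ec i j k))"
      proof (rule diff_bound_divided_diff [OF c2 [unfolded boxc] c_bd [unfolded boxc] h ec])
        show "multi_order 2 (map ec [X_axis, X_axis, Y_axis, Y_axis] @ map snd [])"
          using ec by (simp add: multi_order_def) (simp add: ec_def)
      qed (use nodeO in \<open>simp_all add: nodec boxc\<close>)
      then show ?thesis by (simp add: cg_def nodec)
    qed
    \<comment> \<open>\<open>V/\<tau>\<^sup>2\<close> is a second divided difference in time, based at the previous time level.\<close>
    have V_bound: "diff_bound h A [X_axis, X_axis, Y_axis, Y_axis, Z_axis, Z_axis] (\<tau>\<^sup>2 * Mu) V"
    proof -
      let ?t = "real (n - 1) * \<tau>"
      let ?D = "\<lambda>i j k. divided_diff [(\<tau>, dir_t), (\<tau>, dir_t)] u (grid_node ((x0, y0, z0), ?t) h eu i j k)"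
      have shift: "(q, r) + t *\<^sub>R dir_t = (q, r + t)" for q r t by (simp add: dir_t_def zero_prod_def)
      have t: "?t + \<tau> = real n * \<tau>" "?t + 2 * \<tau> = real (n + 1) * \<tau>"
        using n(1) by (simp_all add: of_nat_diff algebra_simps)
      have "diff_bound h A [X_axis, X_axis, Y_axis, Y_axis, Z_axis, Z_axis] Mu ?D"
      proof (rule diff_bound_divided_diff [OF u6' [unfolded boxu] u_bd [unfolded boxu] h eu])
        show "multi_order 6 (map eu [X_axis, X_axis, Y_axis, Y_axis, Z_axis, Z_axis]
            @ map snd [(\<tau>, dir_t), (\<tau>, dir_t)])"
          using eu dirs
          by (simp add: multi_order_def) (simp add: eu_def dir_x_def dir_y_def dir_z_def dir_t_def)
        fix i j k assume ijk: "(i, j, k) \<in> A"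
        have d: "displacement [(\<tau>, dir_t), (\<tau>, dir_t)] = (2 * \<tau>) *\<^sub>R dir_t"
          by (simp flip: scaleR_2)
        have "(node i j k, ?t) \<in> S" "(node i j k, ?t + 2 * \<tau>) \<in> S"
          using nodeO [OF ijk] times [of "n - 1"] times [of "n + 1"] unfolding t by (simp_all add: S_def)
        then show "grid_node ((x0, y0, z0), ?t) h eu i j k \<in> cbox ((x0, y0, z0), 0) ((x1, y1, z1), T)
            \<and> grid_node ((x0, y0, z0), ?t) h eu i j k + displacement [(\<tau>, dir_t), (\<tau>, dir_t)]
              \<in> cbox ((x0, y0, z0), 0) ((x1, y1, z1), T)"
          unfolding nodeu d shift boxu by blast
      qed (use \<tau> dirs in simp_all)
      from diff_bound_scale [OF this, of "\<tau>\<^sup>2"]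
      have "diff_bound h A [X_axis, X_axis, Y_axis, Y_axis, Z_axis, Z_axis] (\<tau>\<^sup>2 * Mu)
          (\<lambda>i j k. \<tau>\<^sup>2 * ?D i j k)" by simp
      moreover have "\<tau>\<^sup>2 * ?D i j k = V i j k" for i j k
      proof -
        have D: "?D i j k = ((u (node i j k, ?t + 2 * \<tau>) - u (node i j k, ?t + \<tau>)) / \<tau>
            - (u (node i j k, ?t + \<tau>) - u (node i j k, ?t)) / \<tau>) / \<tau>"
          by (simp add: nodeu shift add.assoc flip: mult_2)
        show ?thesis
          unfolding D t V_def using \<tau>
          by (simp add: delta_t2_def central_diff2_def field_simps power2_eq_square)
      qed
      ultimately show ?thesis by simp
    qed

    define px where "px m = along_x (pade ax Nx) (\<lambda>i j k. u (node i j k, real m * \<tau>)) i j k" for m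
    define py where "py m = along_y (pade ay Ny) (\<lambda>i j k. u (node i j k, real m * \<tau>)) i j k" for m
    define pz where "pz m = along_z (pade az Nz) (\<lambda>i j k. u (node i j k, real m * \<tau>)) i j k" for m
    define xx where "xx m = ?uxx (node i j k, real m * \<tau>)" for m
    define yy where "yy m = ?uyy (node i j k, real m * \<tau>)" for m
    define zz where "zz m = ?uzz (node i j k, real m * \<tau>)" for m
    define utt where "utt m = ?utt (node i j k, real m * \<tau>)" for m
    define ex where "ex m = px m / hx\<^sup>2 - xx m" for m
    define ey where "ey m = py m / hy\<^sup>2 - yy m" for m
    define ez where "ez m = pz m / hz\<^sup>2 - zz m" for m
    define sg where "sg m = s (node i j k, real m * \<tau>)" for m
    define Q where "Q = (\<lambda>d. adi_term (\<tau>\<^sup>2 / (h d)\<^sup>2) cg (along d (pade (a d) (N d))))"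
    define lhs where "lhs = adi_lhs \<tau> hx hy hz
           (along_x (pade ax Nx)) (along_y (pade ay Ny)) (along_z (pade az Nz)) cg
           (\<lambda>n i j k. u (node i j k, real n * \<tau>)) n i j k"
    define R where "R = lhs - (V i j k - Q X_axis V i j k - Q Y_axis V i j k - Q Z_axis V i j k)"
    let ?H = "hx ^ 4 + hy ^ 4 + hz ^ 4"

    have R_bound: "\<bar>R\<bar> \<le> (\<tau>\<^sup>2 * L)\<^sup>2 * (3 + \<tau>\<^sup>2 * L) * (\<tau>\<^sup>2 * Mu)"
      using adi_cross_terms [of a N h C Mc cg "\<tau>\<^sup>2 * Mu" V i j k \<tau>, folded A_def Q_def L_def,
          OF aend alen N h C c_bound Mc V_bound _ p] Mu
      unfolding R_def lhs_def adi_lhs_def V_def [symmetric]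
      by (simp add: Q_def h_def a_def N_def along.simps)

    \<comment> \<open>The compact operators commute with \<open>\<delta>\<^sub>t\<^sup>2\<close>, so \<open>P V\<close> is a time difference of \<open>P u\<close>.\<close>
    have linear: "pade b M (\<lambda>m. central_diff2 (\<lambda>n. f n m) n) l = central_diff2 (\<lambda>n. pade b M (f n) l) n"
      if "0 < M" for b M l and f :: "nat \<Rightarrow> nat \<Rightarrow> real"
    proof -
      have "pade b M (\<lambda>m. 1 * (1 * f (n - 1) m + - 2 * f n m) + 1 * f (n + 1) m) l
          = 1 * (1 * pade b M (f (n - 1)) l + - 2 * pade b M (f n) l) + 1 * pade b M (f (n + 1)) l"
        by (simp only: pade_linear [OF that])
      then show ?thesis by (simp add: central_diff2_def)
    qed
    have QV: "Q X_axis V i j k = \<tau>\<^sup>2 / hx\<^sup>2 / 12 * (cg i j k * central_diff2 px n)"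
      "Q Y_axis V i j k = \<tau>\<^sup>2 / hy\<^sup>2 / 12 * (cg i j k * central_diff2 py n)"
      "Q Z_axis V i j k = \<tau>\<^sup>2 / hz\<^sup>2 / 12 * (cg i j k * central_diff2 pz n)"
      using i j k linear
      by (simp_all add: Q_def adi_term_def V_def delta_t2_def [abs_def] px_def [abs_def] py_def [abs_def]
          pz_def [abs_def] along.simps along_x_def along_y_def along_z_def h_def a_def N_def)

    have "s (node i j k, real m * \<tau>) = utt m - cg i j k * (xx m + yy m + zz m)"
      if "m \<in> {n - 1, n, n + 1}" for m
    proof -
      have "real m * \<tau> \<in> {0..T}" using times [OF that] by simp
      then show ?thesis
        using sol nodeO [OF p]
        unfolding acoustic_solution_def S_def [symmetric] utt_def xx_def yy_def zz_def cg_def by simp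
    qed
    then have s_eq: "sg m = utt m - cg i j k * (xx m + yy m + zz m)" if "m \<in> {n - 1, n, n + 1}" for m
      using that by (simp add: sg_def)

    have "adi_residual \<tau> hx hy hz
           (along_x (pade ax Nx)) (along_y (pade ay Ny)) (along_z (pade az Nz)) cg
           (\<lambda>n i j k. u (node i j k, real n * \<tau>))
           (\<lambda>n i j k. s (node i j k, real n * \<tau>)) n i j k
      = (lhs - (cg i j k * (\<tau>\<^sup>2 / hx\<^sup>2 * px n + \<tau>\<^sup>2 / hy\<^sup>2 * py n + \<tau>\<^sup>2 / hz\<^sup>2 * pz n)
            + \<tau>\<^sup>2 * (sg n + central_diff2 sg n / 12))) / \<tau>\<^sup>2"
      by (simp add: adi_residual_def adi_rhs_def lhs_def px_def py_def pz_def sg_def [abs_def] delta_t2_def)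
    also have "\<dots> = (V i j k - \<tau>\<^sup>2 * (utt n + central_diff2 utt n / 12)) / \<tau>\<^sup>2 + R / \<tau>\<^sup>2
       - cg i j k * ((ex n + central_diff2 ex n / 12) + (ey n + central_diff2 ey n / 12)
              + (ez n + central_diff2 ez n / 12))"
      using s_eq \<tau> hpos
      by (intro adi_residual_splitting [where xx = xx and yy = yy and zz = zz])
        (simp_all add: ex_def ey_def ez_def R_def QV)
    finally have split: "adi_residual \<tau> hx hy hz
           (along_x (pade ax Nx)) (along_y (pade ay Ny)) (along_z (pade az Nz)) cg
           (\<lambda>n i j k. u (node i j k, real n * \<tau>))
           (\<lambda>n i j k. s (node i j k, real n * \<tau>)) n i j k = \<dots>" .

    have time: "\<bar>(V i j k - \<tau>\<^sup>2 * (utt n + central_diff2 utt n / 12)) / \<tau>\<^sup>2\<bar> \<le> Mu * \<tau> ^ 4"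
    proof -
      let ?t = "real (n - 1) * \<tau>"
      have shift: "(q, r) + t *\<^sub>R dir_t = (q, r + t)" for q r t by (simp add: dir_t_def zero_prod_def)
      have t: "?t + \<tau> = real n * \<tau>" "?t + 2 * \<tau> = real (n + 1) * \<tau>"
        using n(1) by (simp_all add: of_nat_diff algebra_simps)
      have line: "(node i j k, ?t) + r *\<^sub>R dir_t \<in> S" if "0 \<le> r" "r \<le> 2 * \<tau>" for r
      proof -
        have "?t + r \<le> ?t + 2 * \<tau>" using that by simp
        then have "?t + r \<le> T" unfolding t using times [of "n + 1"] by simp
        moreover have "0 \<le> ?t + r" using times [of "n - 1"] that by simp
        ultimately show ?thesis unfolding shift using nodeO [OF p] by (simp add: S_def)
      qed
      have "\<bar>V i j k - \<tau>\<^sup>2 * (utt n + central_diff2 utt n / 12)\<bar> \<le> Mu * \<tau> ^ 6"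
        using three_point_partial_derivs [OF u6' dirs(4) u_bd \<tau> line] unfolding shift t
        by (simp add: V_def delta_t2_def central_diff2_def utt_def)
      then have "\<bar>V i j k - \<tau>\<^sup>2 * (utt n + central_diff2 utt n / 12)\<bar> / \<tau>\<^sup>2 \<le> Mu * \<tau> ^ 6 / \<tau>\<^sup>2"
        by (rule divide_right_mono) simp
      also have "\<dots> = Mu * \<tau> ^ 4" using \<tau> by (simp add: field_simps flip: power_add)
      finally show ?thesis by simp
    qed

    have cross: "\<bar>R / \<tau>\<^sup>2\<bar> \<le> L\<^sup>2 * (3 + T\<^sup>2 * L) * Mu * \<tau> ^ 4"
    proof -
      \<comment> \<open>The middle factor \<open>3 + \<tau>\<^sup>2 L\<close> is made independent of \<open>\<tau>\<close> by \<open>\<tau> \<le> T\<close>.\<close>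
      have "real 1 * \<tau> \<le> real (n + 1) * \<tau>" using in_line(2) [of 1 "n + 1" \<tau>] \<tau> by simp
      then have "\<tau> \<le> T" using n(2) by linarith
      then have "\<tau>\<^sup>2 \<le> T\<^sup>2" using \<tau> by (simp add: power_mono)
      have "\<bar>R / \<tau>\<^sup>2\<bar> = \<bar>R\<bar> / \<tau>\<^sup>2" by simp
      also have "\<dots> \<le> (\<tau>\<^sup>2 * L)\<^sup>2 * (3 + \<tau>\<^sup>2 * L) * (\<tau>\<^sup>2 * Mu) / \<tau>\<^sup>2"
        by (rule divide_right_mono [OF R_bound]) simp
      also have "\<dots> = (L\<^sup>2 * Mu * \<tau> ^ 4) * (3 + \<tau>\<^sup>2 * L)"
        using \<tau> by (simp add: power_mult_distrib flip: power_mult)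
      also have "\<dots> \<le> (L\<^sup>2 * Mu * \<tau> ^ 4) * (3 + T\<^sup>2 * L)"
        using \<open>\<tau>\<^sup>2 \<le> T\<^sup>2\<close> L Mu by (intro mult_left_mono add_left_mono mult_right_mono) auto
      finally show ?thesis by (simp add: mult_ac)
    qed

    have space: "\<bar>(ex n + central_diff2 ex n / 12) + (ey n + central_diff2 ey n / 12)
              + (ez n + central_diff2 ez n / 12)\<bar> \<le> 4 / 3 * (C * Mu) * ?H"
    proof -
      have inside: "x0 \<le> x0 + real i * hx" "x0 + real i * hx \<le> x1"
          "y0 \<le> y0 + real j * hy" "y0 + real j * hy \<le> y1"
          "z0 \<le> z0 + real k * hz" "z0 + real k * hz \<le> z1"
        using nodeO [OF p] by (simp_all add: node memO)
      have pc: "pade_const b * Mu * r ^ 4 \<le> C * Mu * r ^ 4" if "pade_const b \<le> C" for b r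
        using that Mu by (intro mult_right_mono) auto
      have "\<bar>ex m\<bar> \<le> C * Mu * hx ^ 4" if "m \<in> {n - 1, n, n + 1}" for m
      proof -
        let ?p = "((x0, y0 + real j * hy, z0 + real k * hz), real m * \<tau>)"
        have sh: "?p + r *\<^sub>R dir_x = ((x0 + r, y0 + real j * hy, z0 + real k * hz), real m * \<tau>)" for r
          by (simp add: dir_x_def)
        have "\<bar>ex m\<bar> \<le> pade_const ax * Mu * hx ^ 4"
          using pade_partial_derivs [OF u6' dirs(1) u_bd assms(10) len(1) _ _ hpos(1), of i ?p]
            times [OF that] inside i ends
          unfolding sh by (simp add: memS ex_def px_def xx_def along_x_def node)
        then show ?thesis using pc [OF C [of X_axis]] by (simp add: a_def order_trans)
      qed
      moreover have "\<bar>ey m\<bar> \<le> C * Mu * hy ^ 4" if "m \<in> {n - 1, n, n + 1}" for m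
      proof -
        let ?p = "((x0 + real i * hx, y0, z0 + real k * hz), real m * \<tau>)"
        have sh: "?p + r *\<^sub>R dir_y = ((x0 + real i * hx, y0 + r, z0 + real k * hz), real m * \<tau>)" for r
          by (simp add: dir_y_def)
        have "\<bar>ey m\<bar> \<le> pade_const ay * Mu * hy ^ 4"
          using pade_partial_derivs [OF u6' dirs(2) u_bd assms(11) len(2) _ _ hpos(2), of j ?p]
            times [OF that] inside j ends
          unfolding sh by (simp add: memS ey_def py_def yy_def along_y_def node)
        then show ?thesis using pc [OF C [of Y_axis]] by (simp add: a_def order_trans)
      qed
      moreover have "\<bar>ez m\<bar> \<le> C * Mu * hz ^ 4" if "m \<in> {n - 1, n, n + 1}" for m
      proof -
        let ?p = "((x0 + real i * hx, y0 + real j * hy, z0), real m * \<tau>)"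
        have sh: "?p + r *\<^sub>R dir_z = ((x0 + real i * hx, y0 + real j * hy, z0 + r), real m * \<tau>)" for r
          by (simp add: dir_z_def)
        have "\<bar>ez m\<bar> \<le> pade_const az * Mu * hz ^ 4"
          using pade_partial_derivs [OF u6' dirs(3) u_bd assms(12) len(3) _ _ hpos(3), of k ?p]
            times [OF that] inside k ends
          unfolding sh by (simp add: memS ez_def pz_def zz_def along_z_def node)
        then show ?thesis using pc [OF C [of Z_axis]] by (simp add: a_def order_trans)
      qed
      ultimately have "\<bar>ex n + central_diff2 ex n / 12\<bar> \<le> 4 / 3 * (C * Mu * hx ^ 4)"
        "\<bar>ey n + central_diff2 ey n / 12\<bar> \<le> 4 / 3 * (C * Mu * hy ^ 4)"
        "\<bar>ez n + central_diff2 ez n / 12\<bar> \<le> 4 / 3 * (C * Mu * hz ^ 4)"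
        by (blast intro: central_diff2_perturbation)+
      then show ?thesis
        by (simp only: distrib_left mult.assoc)
    qed
    have "\<bar>cg i j k\<bar> \<le> Mc"
      using c_bd [of "[]" "node i j k"] nodeO [OF p] by (simp add: cg_def partial_derivs_def)
    then have space': "\<bar>cg i j k * ((ex n + central_diff2 ex n / 12) + (ey n + central_diff2 ey n / 12)
              + (ez n + central_diff2 ez n / 12))\<bar> \<le> Mc * (4 / 3 * (C * Mu) * ?H)"
      unfolding abs_mult using space Mc by (intro mult_mono) auto

    have nonneg: "0 \<le> Mc * (4 / 3 * (C * Mu))" "0 \<le> L\<^sup>2 * (3 + T\<^sup>2 * L) * Mu" "0 \<le> \<tau> ^ 4" "0 \<le> ?H"
      using Mc Mu C0 L by simp_all
    have "\<bar>adi_residual \<tau> hx hy hz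
           (along_x (pade ax Nx)) (along_y (pade ay Ny)) (along_z (pade az Nz)) cg
           (\<lambda>n i j k. u (node i j k, real n * \<tau>))
           (\<lambda>n i j k. s (node i j k, real n * \<tau>)) n i j k\<bar>
        \<le> Mu * \<tau> ^ 4 + L\<^sup>2 * (3 + T\<^sup>2 * L) * Mu * \<tau> ^ 4 + Mc * (4 / 3 * (C * Mu) * ?H)"
      unfolding split using time cross space' by linarith
    also have "\<dots> \<le> (Mu + L\<^sup>2 * (3 + T\<^sup>2 * L) * Mu) * \<tau> ^ 4 + (Mc * (4 / 3 * (C * Mu))) * ?H"
      by (simp only: distrib_right mult.assoc)
    also have "\<dots> \<le> K * \<tau> ^ 4 + K * ?H"
      using nonneg Mu by (intro add_mono mult_right_mono) (simp_all add: K_def)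
    finally show ?thesis by (simp add: cg_def distrib_left add.assoc)
  qed
  show ?thesis
    by (rule exI [of _ K]) (auto simp only: Let_def intro!: main)
qed

end
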